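(* Let $n\ge2$ and $k\ge1$ be integers, let $1<p_1,\dots,p_k<\infty$, $\frac1p=\sum_{\iota=1}^k\frac1{p_\iota}$, and $\alpha\ge0$. If $$\alpha<\frac{2n-1}{2p}-\frac{(n-1)k+1}2,$$ then the multilinear maximal estimate $$\big\|B^{k,\alpha}_*(f_1,\dots,f_k)\big\|_{L^p(\mathbb R^n)}\le C\prod_{\iota=1}^k\|f_\iota\|_{L^{p_\iota}(\mathbb R^n)}$$ fails; that is, there is no finite constant $C$ for which it holds for all Schwartz functions $f_1,\dots,f_k$ on $\mathbb R^n$.
   Context: Fourier transform: $\widehat f(\xi)=\int_{\mathbb R^n}f(x)e^{-2\pi i x\cdot\xi}\,dx$. For $\alpha\ge0$ and $\xi=(\xi_1,\dots,\xi_k)\in(\mathbb R^n)^k$ put $m^\alpha(\xi)=(1-|\xi|^2)_+^\alpha$, where $|\xi|^2=|\xi_1|^2+\cdots+|\xi_k|^2$. Define $$B^{k,\alpha}_R(f_1,\dots,f_k)(x)=\int_{\mathbb R^{nk}}m^\alpha(R^{-1}\xi)\prod_{\iota=1}^k\widehat f_\iota(\xi_\iota)\,e^{2\pi i x\cdot(\xi_1+\cdots+\xi_k)}\,d\xi,\qquad B^{k,\alpha}_*(f_1,\dots,f_k)(x)=\sup_{R>0}\big|B^{k,\alpha}_R(f_1,\dots,f_k)(x)\big| .$$ *)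

theory Defs
  imports "HOL-Analysis.Analysis"
begin

text \<open>
  \<open>iter_deriv [b\<^sub>1, \<dots>, b\<^sub>m] f\<close> is the iterated directional derivative of \<open>f\<close> in the directions
  \<open>b\<^sub>1, \<dots>, b\<^sub>m\<close>; for basis vectors these are the partial derivatives of order \<open>m\<close>. (Lists play the
  role of multi-indices.)
\<close>

primrec iter_deriv :: "'a::euclidean_space list \<Rightarrow> ('a \<Rightarrow> complex) \<Rightarrow> 'a \<Rightarrow> complex" where
  "iter_deriv [] f = f"
| "iter_deriv (b # bs) f = (\<lambda>x. frechet_derivative (iter_deriv bs f) (at x) b)"

text \<open>
  Smoothness is the differentiability, everywhere, of all iterated partial derivatives. It has to
  be required explicitly, since \<^const>\<open>frechet_derivative\<close> is unspecified where no derivative exists.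
\<close>

definition schwartz :: "('a::euclidean_space \<Rightarrow> complex) \<Rightarrow> bool" where
  "schwartz f \<longleftrightarrow>
     (\<forall>bs \<in> lists Basis.
        (\<forall>x. iter_deriv bs f differentiable (at x)) \<and>
        (\<forall>N::nat. bounded (range (\<lambda>x. norm x ^ N * norm (iter_deriv bs f x)))))"

definition fourier :: "('a::euclidean_space \<Rightarrow> complex) \<Rightarrow> 'a \<Rightarrow> complex" where
  "fourier f \<xi> = (LINT x|lborel. f x * exp (- 2 * pi * \<i> * (x \<bullet> \<xi>)))"

text \<open>
  A point \<open>\<xi> = (\<xi>\<^sub>1, \<dots>, \<xi>\<^sub>k)\<close> of \<open>(\<real>\<^sup>n)\<^sup>k\<close> is a vector of type \<open>real^'n^'k\<close>, so \<open>n = CARD('n)\<close> and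
  \<open>k = CARD('k)\<close>. The norm of this type is the Euclidean one, \<open>|\<xi>|\<^sup>2 = |\<xi>\<^sub>1|\<^sup>2 + \<dots> + |\<xi>\<^sub>k|\<^sup>2\<close>.
  As \<open>0 powr 0 = 0\<close>, for \<open>\<alpha> = 0\<close> the symbol is the indicator function of the open unit ball.
\<close>

definition br_symbol :: "real \<Rightarrow> real^'n::finite^'k::finite \<Rightarrow> real" where
  "br_symbol \<alpha> \<xi> = max 0 (1 - (norm \<xi>)\<^sup>2) powr \<alpha>"

definition br_mean ::
    "real \<Rightarrow> real \<Rightarrow> ('k::finite \<Rightarrow> real^'n::finite \<Rightarrow> complex) \<Rightarrow> real^'n \<Rightarrow> complex" where
  "br_mean \<alpha> R f x =
     (LINT \<xi>::real^'n^'k|lborel.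
        br_symbol \<alpha> (inverse R *\<^sub>R \<xi>) * (\<Prod>\<iota>\<in>UNIV. fourier (f \<iota>) (\<xi> $ \<iota>))
          * exp (2 * pi * \<i> * (x \<bullet> (\<Sum>\<iota>\<in>UNIV. \<xi> $ \<iota>))))"

definition br_max ::
    "real \<Rightarrow> ('k::finite \<Rightarrow> real^'n::finite \<Rightarrow> complex) \<Rightarrow> real^'n \<Rightarrow> ennreal" where
  "br_max \<alpha> f x = (SUP R\<in>{0<..}. ennreal (norm (br_mean \<alpha> R f x)))"

text \<open>Powers with positive exponent on the extended nonnegative reals, with \<open>\<infinity>\<^sup>p = \<infinity>\<close>.\<close>

definition epowr :: "ennreal \<Rightarrow> real \<Rightarrow> ennreal" where
  "epowr a p = (if a = \<infinity> then \<infinity> else ennreal (enn2real a powr p))"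

text \<open>
  The \<open>L\<^sup>p\<close> (quasi-)norm for \<open>0 < p < \<infinity>\<close>, taken on \<^typ>\<open>ennreal\<close>-valued functions because a maximal
  function may be infinite. For complex \<open>f\<close> it is applied to the absolute value of \<open>f\<close>.
\<close>

definition Lp_norm :: "real \<Rightarrow> ('a::euclidean_space \<Rightarrow> ennreal) \<Rightarrow> ennreal" where
  "Lp_norm p g = epowr (\<integral>\<^sup>+ x. epowr (g x) p \<partial>lborel) (1 / p)"

end

theory Submission
  imports Defs "HOL-Complex_Analysis.Complex_Analysis" "HOL-Probability.Probability"
    "HOL-Real_Asymp.Real_Asymp"
begin

text \<open>
  All \<open>f\<^sub>\<iota>\<close> are one modulated Gaussian (a plate) of width about \<open>m\<^sup>1\<^sup>/\<^sup>2\<close> in a direction \<open>e\<close> and about \<open>1\<close>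
  in the others, with frequency near \<open>e\<close>. On a box of side about \<open>m\<close> at distance about \<open>m\<close> from the
  origin, a suitable radius \<open>R\<close> depending on \<open>x\<close> makes the Riesz mean large.

  No asymptotics of the Riesz kernel is needed. For every weight \<open>w\<close>, the supremum over \<open>R\<close> times
  \<open>\<integral>|w|\<close> dominates \<open>|\<integral> w(t) B\<^bsub>\<surd>t\<^esub> dt|\<close>. The weight \<open>t\<^sup>\<alpha> e\<^sup>-\<^sup>z\<^sup>t\<close> turns the multiplier into
  \<open>\<Gamma>(\<alpha> + 1) z\<^sup>-\<^sup>\<alpha>\<^sup>-\<^sup>1 exp (- z |\<xi>|\<^sup>2)\<close>, a damped Schroedinger propagator that acts explicitly on Gaussians.
  Averaging over \<open>z = 1 + i(Y + v)\<close>, \<open>|v| \<le> a\<close>, with \<open>a\<close> a small multiple of \<open>m\<^sup>1\<^sup>/\<^sup>2\<close>, and modulating so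
  that the phase is stationary at \<open>v = 0\<close> costs no cancellation, while the averaged weight has \<open>L\<^sup>1\<close> norm
  \<open>O(log m)\<close> instead of \<open>O(a)\<close>. This loses only a logarithm, which the strict inequality for \<open>\<alpha>\<close> absorbs.
\<close>

section \<open>Gamma and Gaussian integrals with complex parameters\<close>

text \<open>Power count behind the exponent: for the damped propagator,
  \<open>z powr (- \<alpha> - 1)\<close> contributes m^(-\<alpha>-1) and transversal spreading
  m^(-k(n-1)/2). There is no loss along e, because a width of m^(1/2) only starts to spread after a
  time of about m. Integrating over v gains m^(1/2), so the maximal function is at least about
  m^(-s) / log m on the box, with s = \<alpha> + 1/2 + k(n-1)/2. The box has volume about m^n and
  the product of the norms is at most m^(1/(2p)). The estimate therefore forces n/p - 1/(2p) - s to
  be at most 0, the exact negation of the hypothesis on \<alpha>. The length m^(1/2) of the average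
  is dictated by the second-order term v^2/m of the phase. The time Y = pi x_1 is the one at which a
  packet of frequency e arrives at x_1. The real part 1 of z makes the Gamma integral converge and
  costs only a constant: the stationary value of |\<xi>|^2 stays between k and kn, and the
  exponentially large factors exp(k m) and exp(- k m) cancel.\<close>

lemma norm_exp_minus_one_le:
  fixes w :: complex
  shows "norm (exp w - 1) \<le> norm w * exp (norm w)"
proof -
  have "norm (exp w - exp 0) \<le> exp (norm w) * norm (w - 0)"
  proof (rule field_differentiable_bound[of "cball 0 (norm w)" exp exp])
    fix u :: complex assume "u \<in> cball 0 (norm w)"
    then show "norm (exp u) \<le> exp (norm w)"
      using norm_exp[of u] by (auto intro: order_trans)
  qed (auto intro!: derivative_eq_intros)
  then show ?thesis by (simp add: mult.commute)
qed

text \<open>Differentiation under the integral sign. Integrability at the two points z + \<eta> and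
  z - \<eta> already dominates all difference quotients near z, since exp (\<eta> |h|) is at most
  exp (\<eta> h) + exp (- \<eta> h).\<close>

lemma holomorphic_on_exp_integral:
  fixes h :: "'a \<Rightarrow> real" and w :: "'a \<Rightarrow> complex"
  assumes S: "open S" and [measurable]: "h \<in> borel_measurable M" "w \<in> borel_measurable M"
    and int: "\<And>z :: complex. z \<in> S \<Longrightarrow> integrable M (\<lambda>x. w x * exp (z * of_real (h x)))"
  shows "(\<lambda>z::complex. LINT x|M. w x * exp (z * of_real (h x))) holomorphic_on S"
unfolding holomorphic_on_open[OF S]
proof
  fix z :: complex assume z: "z \<in> S"
  obtain e where e: "e > 0" "ball z e \<subseteq> S" using S z open_contains_ball by blast
  define \<eta> where "\<eta> = e / 2"
  have \<eta>: "\<eta> > 0" using e by (simp add: \<eta>_def)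
  have zS: "z + of_real \<eta> \<in> S" "z - of_real \<eta> \<in> S"
    using e by (auto simp: \<eta>_def dist_norm intro!: subsetD[OF e(2)])
  let ?F = "\<lambda>z::complex. LINT x|M. w x * exp (z * of_real (h x))"
  let ?b = "\<lambda>x. (2 / \<eta>) * (norm (w x * exp ((z + of_real \<eta>) * of_real (h x))) + norm (w x * exp ((z - of_real \<eta>) * of_real (h x))))"
  have intb: "integrable M ?b" using int zS by (intro integrable_mult_right integrable_add integrable_norm) auto
  have "((\<lambda>y. (?F y - ?F z) / (y - z)) \<longlongrightarrow> (LINT x|M. w x * (of_real (h x) * exp (z * of_real (h x))))) (at z within ball z (\<eta>/2))"
    unfolding tendsto_at_iff_sequentially
  proof (intro allI impI)
    fix X :: "nat \<Rightarrow> complex" assume X: "\<forall>i. X i \<in> ball z (\<eta>/2) - {z}" and lim: "X \<longlonglongrightarrow> z"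
    let ?s = "\<lambda>i x. (w x * exp (X i * of_real (h x)) - w x * exp (z * of_real (h x))) / (X i - z)"
    have "(\<lambda>i. LINT x|M. ?s i x) \<longlonglongrightarrow> (LINT x|M. w x * (of_real (h x) * exp (z * of_real (h x))))"
    proof (rule integral_dominated_convergence[where w="?b"])
      show "AE x in M. (\<lambda>i. ?s i x) \<longlonglongrightarrow> w x * (of_real (h x) * exp (z * of_real (h x)))"
      proof (intro AE_I2)
        fix x
        have "((\<lambda>z. w x * exp (z * of_real (h x))) has_field_derivative w x * (of_real (h x) * exp (z * of_real (h x)))) (at z)"
          by (auto intro!: derivative_eq_intros)
        then have "((\<lambda>y. (w x * exp (y * of_real (h x)) - w x * exp (z * of_real (h x))) / (y - z)) \<longlongrightarrow> w x * (of_real (h x) * exp (z * of_real (h x)))) (at z)"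
          by (simp add: has_field_derivative_iff)
        then show "(\<lambda>i. ?s i x) \<longlonglongrightarrow> w x * (of_real (h x) * exp (z * of_real (h x)))"
          unfolding tendsto_at_iff_sequentially comp_def using X lim by auto
      qed
      show "AE x in M. norm (?s i x) \<le> ?b x" for i
      proof (intro AE_I2)
        fix x
        define d where "d = X i - z"
        have d: "d \<noteq> 0" "norm d < \<eta>/2" using X by (auto simp: d_def dist_norm norm_minus_commute)
        have "?s i x = w x * exp (z * of_real (h x)) * (exp (d * of_real (h x)) - 1) / d"
          by (simp add: d_def algebra_simps exp_add[symmetric] divide_simps exp_diff)
        then have "norm (?s i x) = norm (w x) * exp (Re z * h x) * (norm (exp (d * of_real (h x)) - 1) / norm d)"
          by (simp add: norm_mult norm_divide)
        also have "norm (exp (d * of_real (h x)) - 1) / norm d \<le> \<bar>h x\<bar> * exp (norm d * \<bar>h x\<bar>)"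
          using norm_exp_minus_one_le[of "d * of_real (h x)"] d by (simp add: norm_mult field_simps)
        also have "\<dots> \<le> \<bar>h x\<bar> * exp (\<eta>/2 * \<bar>h x\<bar>)"
          
        proof -
          have "norm d * \<bar>h x\<bar> \<le> \<eta>/2 * \<bar>h x\<bar>" using d by (intro mult_right_mono) auto
          then show ?thesis by (intro mult_left_mono) auto
        qed
        \<comment> \<open>Half of the exponential margin has paid for the increment of the
          exponential; the other half now absorbs the factor |h| that comes from the
          derivative.\<close>
        also have "\<dots> \<le> (2/\<eta> * exp (\<eta>/2 * \<bar>h x\<bar>)) * exp (\<eta>/2 * \<bar>h x\<bar>)"
        proof (intro mult_right_mono)
          have "\<eta>/2 * \<bar>h x\<bar> \<le> exp (\<eta>/2 * \<bar>h x\<bar>)"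
            using exp_ge_add_one_self[of "\<eta>/2 * \<bar>h x\<bar>"] by linarith
          then show "\<bar>h x\<bar> \<le> 2/\<eta> * exp (\<eta>/2 * \<bar>h x\<bar>)" using \<eta> by (simp add: field_simps)
        qed auto
        also have "\<dots> = 2/\<eta> * exp (\<eta> * \<bar>h x\<bar>)" by (simp add: exp_add[symmetric])
        also have "\<dots> \<le> 2/\<eta> * (exp (\<eta> * h x) + exp (- \<eta> * h x))"
          using \<eta> by (intro mult_left_mono) (auto simp: abs_if)
        finally have "norm (?s i x) \<le> norm (w x) * exp (Re z * h x) * (2/\<eta> * (exp (\<eta> * h x) + exp (- \<eta> * h x)))"
          by (simp add: mult_left_mono)
        also have "\<dots> = ?b x"
        proof -
          have "norm (w x * exp ((z + of_real \<eta>) * of_real (h x))) = norm (w x) * (exp (Re z * h x) * exp (\<eta> * h x))"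
            "norm (w x * exp ((z - of_real \<eta>) * of_real (h x))) = norm (w x) * (exp (Re z * h x) * exp (- \<eta> * h x))"
            unfolding exp_add[symmetric] by (simp_all add: norm_mult algebra_simps)
          then show ?thesis by (simp add: distrib_left mult_ac)
        qed
        finally show "norm (?s i x) \<le> ?b x" .
      qed
    qed (use intb in auto)
    moreover have "(LINT x|M. ?s i x) = (?F (X i) - ?F z) / (X i - z)" for i
    proof -
      have "X i \<in> S" using X e by (intro subsetD[OF e(2)]) (auto simp: \<eta>_def dest!: spec[of _ i])
      then show ?thesis using int z by simp
    qed
    ultimately show "((\<lambda>y. (?F y - ?F z) / (y - z)) \<circ> X) \<longlonglongrightarrow> (LINT x|M. w x * (of_real (h x) * exp (z * of_real (h x))))"
      by (simp only: comp_def)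
  qed
  then have "(?F has_field_derivative (LINT x|M. w x * (of_real (h x) * exp (z * of_real (h x))))) (at z)"
    using \<eta> by (simp add: has_field_derivative_iff at_within_open[of z "ball z (\<eta>/2)"])
  then show "\<exists>D. ((\<lambda>z. LINT x|M. w x * exp (z * of_real (h x))) has_field_derivative D) (at z)" by blast
qed

text \<open>The identity theorem, with 1 as the limit point of the positive reals. It carries the
  real Gamma and Gaussian integrals to complex parameters.\<close>

lemma analytic_continuation_real_axis:
  fixes f g :: "complex \<Rightarrow> complex"
  assumes "open S" "connected S" "f holomorphic_on S" "g holomorphic_on S"
    and "\<And>y. y > 0 \<Longrightarrow> of_real y \<in> S"
    and "\<And>y. y > 0 \<Longrightarrow> f (of_real y) = g (of_real y)" and "z \<in> S"
  shows "f z = g z"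
proof -
  have "f z - g z = 0"
  proof (rule analytic_continuation[of "\<lambda>z. f z - g z" S "of_real ` {0<..}" 1 z])
    show "(1::complex) islimpt complex_of_real ` {0<..}"
      unfolding islimpt_approachable
    proof (intro allI impI)
      fix e :: real assume "e > 0"
      moreover have "complex_of_real (1 + e/2) - 1 = of_real (e/2)" by simp
      ultimately show "\<exists>x'\<in>complex_of_real ` {0<..}. x' \<noteq> 1 \<and> dist x' 1 < e"
        by (intro bexI[of _ "of_real (1 + e/2)"]) (auto simp: dist_norm simp del: of_real_add of_real_divide)
    qed
  qed (use assms(5)[of 1] in \<open>auto intro!: holomorphic_intros assms\<close>)
  then show ?thesis by simp
qed

lemma has_bochner_integral_Gamma_real:
  fixes s a :: real
  assumes s: "s > 0" and a: "a > 0"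
  shows "has_bochner_integral lborel (\<lambda>t. indicator {0<..} t * t powr (s - 1) * exp (- a * t)) (Gamma s * a powr (- s))"
proof -
  have "((\<lambda>t. t powr (s - 1) / exp t) has_integral Gamma s) {0..}"
    by (rule Gamma_integral_real) fact
  then have "((\<lambda>t. t powr (s - 1) * exp (- t)) has_integral Gamma s) {0..}"
    by (simp add: exp_minus field_simps)
  then have "integral\<^sup>N lborel (\<lambda>t. ennreal (indicator {0..} t * (t powr (s - 1) * exp (- t)))) = Gamma s"
    by (intro nn_integral_has_integral_lebesgue) auto
  also have "integral\<^sup>N lborel (\<lambda>t. ennreal (indicator {0..} t * (t powr (s - 1) * exp (- t))))
      = integral\<^sup>N lborel (\<lambda>t. ennreal (indicator {0<..} t * t powr (s - 1) * exp (- t)))"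
    by (intro nn_integral_cong) (auto simp: indicator_def)
  finally have "has_bochner_integral lborel (\<lambda>t. indicator {0<..} t * t powr (s - 1) * exp (- t)) (Gamma s)"
    using s by (intro has_bochner_integral_nn_integral) (auto intro: less_imp_le[OF Gamma_real_pos])
  then have "has_bochner_integral lborel (\<lambda>t. indicator {0<..} (0 + a * t) * (0 + a * t) powr (s - 1) * exp (- (0 + a * t))) (Gamma s /\<^sub>R \<bar>a\<bar>)"
    by (subst (asm) lborel_has_bochner_integral_real_affine_iff[of a _ _ 0]) (use a in auto)
  then have "has_bochner_integral lborel (\<lambda>t. a powr (1 - s) * (indicator {0<..} (0 + a * t) * (0 + a * t) powr (s - 1) * exp (- (0 + a * t)))) (a powr (1 - s) * (Gamma s /\<^sub>R \<bar>a\<bar>))"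
    by (rule has_bochner_integral_mult_right)
  moreover have "(\<lambda>t. a powr (1 - s) * (indicator {0<..} (0 + a * t) * (0 + a * t) powr (s - 1) * exp (- (0 + a * t))))
     = (\<lambda>t. indicator {0<..} t * t powr (s - 1) * exp (- a * t))"
  proof
    fix t :: real
    show "a powr (1 - s) * (indicator {0<..} (0 + a * t) * (0 + a * t) powr (s - 1) * exp (- (0 + a * t))) = indicator {0<..} t * t powr (s - 1) * exp (- a * t)"
    proof (cases "t > 0")
      case True
      then have "(a * t) powr (s - 1) = a powr (s - 1) * t powr (s - 1)"
        using a by (simp add: powr_mult)
      moreover have "a powr (1 - s) * a powr (s - 1) = 1" using a by (simp flip: powr_add)
      ultimately show ?thesis using True a by (simp add: indicator_def)
    qed (use a in \<open>auto simp: indicator_def zero_less_mult_iff\<close>)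
  qed
  moreover have "a powr (1 - s) * (Gamma s /\<^sub>R \<bar>a\<bar>) = Gamma s * a powr (- s)"
    using a by (simp add: powr_diff powr_minus field_simps)
  ultimately show ?thesis by (simp only:)
qed

text \<open>Continuation in z over the right half plane, where the principal branch in
  \<open>powr\<close> is holomorphic. Integrability only depends on the real part of z.\<close>

lemma has_bochner_integral_Gamma_complex:
  fixes s :: real and z :: complex
  assumes s: "s > 0" and z: "Re z > 0"
  shows "has_bochner_integral lborel (\<lambda>t. of_real (indicator {0<..} t * t powr (s - 1)) * exp (- z * of_real t)) (Gamma s * z powr (- of_real s))"
proof -
  let ?w = "\<lambda>t. complex_of_real (indicator {0<..} t * t powr (s - 1))"
  let ?S = "{z::complex. Re z > 0}"
  have real: "has_bochner_integral lborel (\<lambda>t. ?w t * exp (of_real y * of_real (- t))) (complex_of_real (Gamma s) * complex_of_real y powr (- of_real s))"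
    if "y > 0" for y :: real
  proof -
    have "has_bochner_integral lborel (\<lambda>t. complex_of_real (indicator {0<..} t * t powr (s - 1) * exp (- y * t))) (complex_of_real (Gamma s * y powr (- s)))"
      using that s by (intro has_bochner_integral_of_real has_bochner_integral_Gamma_real)
    moreover have "complex_of_real (y powr (- s)) = of_real y powr (- of_real s)"
      using powr_of_real[of y "- s"] that by simp
    ultimately show ?thesis by (simp add: exp_of_real[symmetric])
  qed
  have int: "integrable lborel (\<lambda>t. ?w t * exp (z * of_real (- t)))" if "z \<in> ?S" for z
  proof -
    have "integrable lborel (\<lambda>t. norm (?w t * exp (z * of_real (- t))))"
      using has_bochner_integral_Gamma_real[of s "Re z"] that s
      by (simp add: norm_mult has_bochner_integral_iff abs_mult)
    then show ?thesis by (rule integrable_norm_cancel) auto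
  qed
  have "(LINT t|lborel. ?w t * exp (z * of_real (- t))) = Gamma s * z powr (- of_real s)"
  proof (rule analytic_continuation_real_axis[where S = ?S and z = z
        and f = "(\<lambda>z::complex. LINT t|lborel. ?w t * exp (z * of_real (- t)))" and g = "(\<lambda>z::complex. Gamma s * z powr (- of_real s))"])
    show "(\<lambda>z::complex. LINT t|lborel. ?w t * exp (z * of_real (- t))) holomorphic_on ?S"
      by (intro holomorphic_on_exp_integral int) (auto simp: open_halfspace_Re_gt)
    show "(\<lambda>z::complex. Gamma s * z powr (- of_real s)) holomorphic_on ?S"
      by (auto intro!: holomorphic_intros simp: complex_nonpos_Reals_iff)
    show "connected ?S" by (intro convex_connected convex_halfspace_Re_gt)
    show "(LINT t|lborel. ?w t * exp (of_real y * of_real (- t))) = Gamma s * complex_of_real y powr (- of_real s)" if "y > 0" for y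
      using real[OF that] by (simp only: has_bochner_integral_iff)
  qed (use z in \<open>auto simp: open_halfspace_Re_gt\<close>)
  then show ?thesis using int[of z] z by (simp add: has_bochner_integral_iff)
qed

lemma has_bochner_integral_gaussian_real:
  fixes a c :: real
  assumes a: "a > 0"
  shows "has_bochner_integral lborel (\<lambda>x. exp (c * x - a * x\<^sup>2)) (sqrt pi * a powr (-1/2) * exp (c\<^sup>2 / (4 * a)))"
proof -
  define \<sigma> where "\<sigma> = sqrt (1 / (2 * a))"
  have \<sigma>: "\<sigma> > 0" "\<sigma>\<^sup>2 = 1 / (2 * a)" using a by (auto simp: \<sigma>_def)
  have "has_bochner_integral lborel (\<lambda>x. (sqrt pi * a powr (-1/2) * exp (c\<^sup>2 / (4 * a))) * normal_density (c / (2 * a)) \<sigma> x)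
     ((sqrt pi * a powr (-1/2) * exp (c\<^sup>2 / (4 * a))) * 1)"
    using \<sigma> by (intro has_bochner_integral_mult_right) (auto simp: has_bochner_integral_iff)
  moreover have "(\<lambda>x. (sqrt pi * a powr (-1/2) * exp (c\<^sup>2 / (4 * a))) * normal_density (c / (2 * a)) \<sigma> x) = (\<lambda>x. exp (c * x - a * x\<^sup>2))"
  proof
    fix x
    have 1: "a powr - (1/2) = 1 / sqrt a" using a by (simp add: powr_minus_divide powr_half_sqrt)
    have 2: "c\<^sup>2 / (4 * a) + - (x - c / (2 * a))\<^sup>2 / (2 * \<sigma>\<^sup>2) = c * x - a * x\<^sup>2"
      unfolding \<sigma>(2) using a by (simp add: field_simps power2_eq_square)
    have "sqrt (2 * pi * \<sigma>\<^sup>2) = sqrt pi / sqrt a" unfolding \<sigma>(2) using a by (simp add: real_sqrt_divide)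
    then have "(sqrt pi * a powr (-1/2) * exp (c\<^sup>2 / (4 * a))) * normal_density (c / (2 * a)) \<sigma> x
      = exp (c\<^sup>2 / (4 * a)) * exp (- (x - c / (2 * a))\<^sup>2 / (2 * \<sigma>\<^sup>2))"
      using a by (simp add: normal_density_def 1)
    then show "(sqrt pi * a powr (-1/2) * exp (c\<^sup>2 / (4 * a))) * normal_density (c / (2 * a)) \<sigma> x = exp (c * x - a * x\<^sup>2)"
      unfolding exp_add[symmetric] 2 .
  qed
  ultimately show ?thesis by simp
qed

text \<open>Two continuations, one variable at a time: in c over the whole plane while a is still
  real, then in a over the right half plane with the complex c fixed.\<close>

lemma has_bochner_integral_gaussian_complex:
  fixes a c :: complex
  assumes a: "Re a > 0"
  shows "has_bochner_integral lborel (\<lambda>x::real. exp (c * of_real x - a * of_real (x\<^sup>2))) (of_real (sqrt pi) * a powr (-1/2) * exp (c\<^sup>2 / (4 * a)))"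
proof -
  have int: "integrable lborel (\<lambda>x::real. exp (c * of_real x - a * of_real (x\<^sup>2)))" if "Re a > 0" for a c :: complex
  proof -
    have "integrable lborel (\<lambda>x::real. norm (exp (c * of_real x - a * of_real (x\<^sup>2))))"
      using has_bochner_integral_gaussian_real[OF that, of "Re c"] by (simp add: has_bochner_integral_iff)
    then show ?thesis by (rule integrable_norm_cancel) auto
  qed
  have 1: "(LINT x::real|lborel. exp (complex_of_real c * of_real x - of_real a * of_real (x\<^sup>2)))
      = of_real (sqrt pi) * of_real a powr (-1/2) * exp ((of_real c)\<^sup>2 / (4 * of_real a))" if "a > 0" for a c :: real
  proof -
    have "(LINT x::real|lborel. complex_of_real (exp (c * x - a * x\<^sup>2))) = of_real (sqrt pi * a powr (-1/2) * exp (c\<^sup>2 / (4 * a)))"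
      using has_bochner_integral_gaussian_real[OF that, of c] by (simp only: has_bochner_integral_iff integral_complex_of_real)
    moreover have "complex_of_real (a powr (-1/2)) = of_real a powr (-1/2)"
      using that by (simp add: powr_of_real[symmetric])
    ultimately show ?thesis by (simp add: exp_of_real[symmetric])
  qed
  have 2: "(LINT x::real|lborel. exp (c * of_real x - of_real a * of_real (x\<^sup>2)))
      = of_real (sqrt pi) * of_real a powr (-1/2) * exp (c\<^sup>2 / (4 * of_real a))" if "a > 0" for a :: real and c :: complex
  proof (rule analytic_continuation_real_axis[where S = UNIV and z = c
        and f = "\<lambda>c::complex. LINT x::real|lborel. exp (c * of_real x - of_real a * of_real (x\<^sup>2))"
        and g = "\<lambda>c::complex. of_real (sqrt pi) * of_real a powr (-1/2) * exp (c\<^sup>2 / (4 * of_real a))"])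
    have "(\<lambda>c::complex. LINT x::real|lborel. exp (- of_real a * of_real (x\<^sup>2)) * exp (c * of_real x)) holomorphic_on UNIV"
      using int[of "of_real a"] that by (intro holomorphic_on_exp_integral) (auto simp: exp_add[symmetric] algebra_simps)
    then show "(\<lambda>c::complex. LINT x::real|lborel. exp (c * of_real x - of_real a * of_real (x\<^sup>2))) holomorphic_on UNIV"
      by (simp add: exp_add[symmetric] algebra_simps)
    show "(\<lambda>c::complex. of_real (sqrt pi) * of_real a powr (-1/2) * exp (c\<^sup>2 / (4 * of_real a))) holomorphic_on UNIV"
      using that by (auto intro!: holomorphic_intros)
  qed (use 1 that in \<open>auto simp: connected_UNIV\<close>)
  have "(LINT x::real|lborel. exp (c * of_real x - a * of_real (x\<^sup>2)))
      = of_real (sqrt pi) * a powr (-1/2) * exp (c\<^sup>2 / (4 * a))"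
  proof (rule analytic_continuation_real_axis[where S = "{z. Re z > 0}" and z = a
        and f = "\<lambda>a::complex. LINT x::real|lborel. exp (c * of_real x - a * of_real (x\<^sup>2))"
        and g = "\<lambda>a::complex. of_real (sqrt pi) * a powr (-1/2) * exp (c\<^sup>2 / (4 * a))"])
    have "(\<lambda>a::complex. LINT x::real|lborel. exp (c * of_real x) * exp (a * of_real (- (x\<^sup>2)))) holomorphic_on {z. Re z > 0}"
      using int[of _ c] by (intro holomorphic_on_exp_integral) (auto simp: exp_add[symmetric] open_halfspace_Re_gt)
    then show "(\<lambda>a::complex. LINT x::real|lborel. exp (c * of_real x - a * of_real (x\<^sup>2))) holomorphic_on {z. Re z > 0}"
      by (simp add: exp_add[symmetric])
    show "(\<lambda>a::complex. of_real (sqrt pi) * a powr (-1/2) * exp (c\<^sup>2 / (4 * a))) holomorphic_on {z. Re z > 0}"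
      by (auto intro!: holomorphic_intros simp: complex_nonpos_Reals_iff)
    show "connected {z. Re z > 0}" by (intro convex_connected convex_halfspace_Re_gt)
  qed (use 2 a in \<open>auto simp: open_halfspace_Re_gt\<close>)
  then show ?thesis using int[OF a, of c] by (simp add: has_bochner_integral_iff)
qed

lemma has_bochner_integral_lborel_prod:
  fixes f :: "'a::euclidean_space \<Rightarrow> real \<Rightarrow> complex"
  assumes f: "\<And>b. b \<in> Basis \<Longrightarrow> has_bochner_integral lborel (f b) (I b)"
  shows "has_bochner_integral lborel (\<lambda>x::'a. \<Prod>b\<in>Basis. f b (x \<bullet> b)) (\<Prod>b\<in>Basis. I b)"
proof -
  interpret product_sigma_finite "\<lambda>_::'a. lborel :: real measure" ..
  let ?P = "\<Pi>\<^sub>M b\<in>(Basis::'a set). (lborel :: real measure)"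
  let ?T = "\<lambda>g. \<Sum>b\<in>(Basis::'a set). g b *\<^sub>R b :: 'a"
  have f': "integrable lborel (f b)" "integral\<^sup>L lborel (f b) = I b" if "b \<in> Basis" for b
    using f[OF that] by (auto simp: has_bochner_integral_iff)
  have m: "(\<lambda>x::'a. \<Prod>b\<in>Basis. f b (x \<bullet> b)) \<in> borel_measurable borel"
  proof (intro borel_measurable_prod)
    fix b :: 'a assume "b \<in> Basis"
    then have "f b \<in> borel_measurable borel"
      using borel_measurable_integrable[OF f'(1)] by simp
    then show "(\<lambda>x. f b (x \<bullet> b)) \<in> borel_measurable borel"
      by (rule measurable_compose[rotated]) auto
  qed
  have T: "?T \<in> measurable ?P borel"
  proof (intro borel_measurable_sum)
    fix b :: 'a assume "b \<in> Basis"
    then have "(\<lambda>g. g b) \<in> measurable ?P borel"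
      using measurable_component_singleton[of b Basis "\<lambda>_. lborel :: real measure"] by simp
    then show "(\<lambda>g. g b *\<^sub>R b) \<in> measurable ?P borel" by measurable
  qed
  have L: "(lborel :: 'a measure) = distr ?P borel ?T" by (rule lborel_eq)
  have e: "(\<lambda>g. \<Prod>b\<in>Basis. f b (?T g \<bullet> b)) = (\<lambda>g. \<Prod>b\<in>Basis. f b (g b))"
    by (intro ext prod.cong) auto
  have "integrable lborel (\<lambda>x::'a. \<Prod>b\<in>Basis. f b (x \<bullet> b))"
    unfolding L integrable_distr_eq[OF T m] e
    by (intro product_integrable_prod f') auto
  moreover have "integral\<^sup>L lborel (\<lambda>x::'a. \<Prod>b\<in>Basis. f b (x \<bullet> b)) = (\<Prod>b\<in>Basis. I b)"
    unfolding L integral_distr[OF T m] e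
    by (subst product_integral_prod) (auto simp: f')
  ultimately show ?thesis by (simp add: has_bochner_integral_iff)
qed

section \<open>Gaussians as Schwartz functions\<close>

text \<open>Diagonal quadratic forms with complex coefficients are enough here. The family contains
  the plates, their Fourier transforms up to a constant and, on the k-fold product space, the whole
  integrand of the propagator.\<close>

definition gauss :: "('a::euclidean_space \<Rightarrow> complex) \<Rightarrow> ('a \<Rightarrow> complex) \<Rightarrow> 'a \<Rightarrow> complex" where
  "gauss a c x = exp (\<Sum>b\<in>Basis. c b * of_real (x \<bullet> b) - a b * of_real ((x \<bullet> b)\<^sup>2))"

lemma has_bochner_integral_gauss:
  fixes a c :: "'a::euclidean_space \<Rightarrow> complex"
  assumes "\<And>b. b \<in> Basis \<Longrightarrow> Re (a b) > 0"
  shows "has_bochner_integral lborel (gauss a c)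
    (\<Prod>b\<in>Basis. of_real (sqrt pi) * a b powr (-1/2) * exp ((c b)\<^sup>2 / (4 * a b)))"
proof -
  have "gauss a c = (\<lambda>x. \<Prod>b\<in>Basis. exp (c b * of_real (x \<bullet> b) - a b * of_real ((x \<bullet> b)\<^sup>2)))"
    by (simp add: gauss_def exp_sum fun_eq_iff)
  then show ?thesis
    using has_bochner_integral_lborel_prod[OF has_bochner_integral_gaussian_complex[OF assms], of "\<lambda>b. b" c] by simp
qed

text \<open>Complex polynomials in the coordinates, described only by how they are built. Closure
  under derivatives and subexponential growth are all that the Schwartz property of Gaussians
  requires, so no degree is tracked.\<close>

inductive cpoly :: "('a::euclidean_space \<Rightarrow> complex) \<Rightarrow> bool" where
  const: "cpoly (\<lambda>x. k)"
| coord: "cpoly (\<lambda>x. of_real (x \<bullet> b))"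
| add: "cpoly q \<Longrightarrow> cpoly r \<Longrightarrow> cpoly (\<lambda>x. q x + r x)"
| mult: "cpoly q \<Longrightarrow> cpoly r \<Longrightarrow> cpoly (\<lambda>x. q x * r x)"

lemma cpoly_sum: "(\<And>i. i \<in> I \<Longrightarrow> cpoly (q i)) \<Longrightarrow> cpoly (\<lambda>x. \<Sum>i\<in>I. q i x)"
  by (induction I rule: infinite_finite_induct) (auto intro: cpoly.intros)

lemma cpoly_has_derivative:
  assumes "cpoly q"
  shows "\<exists>D. (\<forall>x. (q has_derivative D x) (at x)) \<and> (\<forall>v. cpoly (\<lambda>x. D x v))"
  using assms
proof induction
  case (const k)
  show ?case by (rule exI[of _ "\<lambda>x v. 0"]) (auto intro: cpoly.intros)
next
  case (coord b)
  show ?case by (rule exI[of _ "\<lambda>x v. of_real (v \<bullet> b)"]) (auto intro!: cpoly.intros derivative_eq_intros)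
next
  case (add q r)
  then obtain D E where "\<forall>x. (q has_derivative D x) (at x)" "\<forall>v. cpoly (\<lambda>x. D x v)"
    "\<forall>x. (r has_derivative E x) (at x)" "\<forall>v. cpoly (\<lambda>x. E x v)" by blast
  then show ?case
    by (intro exI[of _ "\<lambda>x v. D x v + E x v"]) (auto intro!: cpoly.intros has_derivative_add)
next
  case (mult q r)
  then obtain D E where "\<forall>x. (q has_derivative D x) (at x)" "\<forall>v. cpoly (\<lambda>x. D x v)"
    "\<forall>x. (r has_derivative E x) (at x)" "\<forall>v. cpoly (\<lambda>x. E x v)" by blast
  then show ?case using mult.hyps
    by (intro exI[of _ "\<lambda>x v. q x * E x v + D x v * r x"]) (auto intro!: cpoly.intros has_derivative_mult)
qed

lemma le_exp_scaled:
  fixes e r :: real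
  assumes "e > 0"
  shows "r \<le> 1 / e * exp (e * r)"
proof -
  have "e * r \<le> exp (e * r)" using exp_ge_add_one_self[of "e * r"] by linarith
  then show ?thesis using assms by (simp add: field_simps)
qed

text \<open>An arbitrarily small exponential rate replaces the degree: in a product, each factor is
  given half of the rate.\<close>

lemma cpoly_growth:
  assumes "cpoly q"
  shows "e > 0 \<Longrightarrow> \<exists>C. \<forall>x. norm (q x) \<le> C * exp (e * norm x)"
  using assms
proof (induction arbitrary: e)
  case (const k)
  have "norm k * 1 \<le> norm k * exp (e * norm x)" for x :: 'a
    using const by (intro mult_left_mono) auto
  then show ?case by auto
next
  case (coord b)
  have "norm (complex_of_real (x \<bullet> b)) \<le> (norm b * (1 / e)) * exp (e * norm x)" for x :: 'a
  proof -
    have "norm (complex_of_real (x \<bullet> b)) \<le> norm b * norm x"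
      using Cauchy_Schwarz_ineq2[of x b] by (simp add: mult.commute)
    also have "\<dots> \<le> norm b * (1 / e * exp (e * norm x))"
      by (intro mult_left_mono le_exp_scaled coord) auto
    finally show ?thesis by (simp add: mult.assoc)
  qed
  then show ?case by blast
next
  case (add q r)
  then obtain C D where "\<And>x. norm (q x) \<le> C * exp (e * norm x)" "\<And>x. norm (r x) \<le> D * exp (e * norm x)"
    by metis
  then have "norm (q x + r x) \<le> (C + D) * exp (e * norm x)" for x
    by (metis distrib_right norm_triangle_mono)
  then show ?case by blast
next
  case (mult q r)
  then obtain C D where 1: "\<And>x. norm (q x) \<le> C * exp (e/2 * norm x)" "\<And>x. norm (r x) \<le> D * exp (e/2 * norm x)"
    by (metis half_gt_zero)
  have "norm (q x * r x) \<le> (C * D) * exp (e * norm x)" for x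
  proof -
    have "norm (q x * r x) \<le> (C * exp (e/2 * norm x)) * (D * exp (e/2 * norm x))"
      unfolding norm_mult
      by (intro mult_mono 1 order_trans[OF norm_ge_zero 1(1)] norm_ge_zero)
    also have "\<dots> = (C * D) * exp (e * norm x)"
    proof -
      have "exp (e * norm x) = exp (e/2 * norm x) * exp (e/2 * norm x)" unfolding exp_add[symmetric] by simp
      then show ?thesis by (simp only: mult_ac)
    qed
    finally show ?thesis .
  qed
  then show ?case by blast
qed

lemma gauss_has_derivative:
  "(gauss a c has_derivative (\<lambda>v. (\<Sum>b\<in>Basis. c b * of_real (v \<bullet> b) - a b * (2 * of_real (x \<bullet> b) * of_real (v \<bullet> b))) * gauss a c x)) (at x)"
proof -
  have "((\<lambda>x. \<Sum>b\<in>Basis. c b * of_real (x \<bullet> b) - a b * of_real ((x \<bullet> b)\<^sup>2)) has_derivative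
    (\<lambda>v. \<Sum>b\<in>Basis. c b * of_real (v \<bullet> b) - a b * (2 * of_real (x \<bullet> b) * of_real (v \<bullet> b)))) (at x)"
    by (auto intro!: derivative_eq_intros sum.cong)
  then have "((\<lambda>x. exp (\<Sum>b\<in>Basis. c b * of_real (x \<bullet> b) - a b * of_real ((x \<bullet> b)\<^sup>2))) has_derivative
    (\<lambda>v. (\<Sum>b\<in>Basis. c b * of_real (v \<bullet> b) - a b * (2 * of_real (x \<bullet> b) * of_real (v \<bullet> b))) *
       exp (\<Sum>b\<in>Basis. c b * of_real (x \<bullet> b) - a b * of_real ((x \<bullet> b)\<^sup>2)))) (at x)"
    by (rule has_derivative_eq_rhs[OF has_derivative_compose[OF _ DERIV_exp[unfolded has_field_derivative_def]]]) (auto simp: mult.commute)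
  then show ?thesis unfolding gauss_def[abs_def] .
qed

text \<open>Polynomials times a fixed Gaussian are closed under directional derivatives, because the
  logarithmic derivative of a Gaussian is affine.\<close>

lemma iter_deriv_gauss: "\<exists>q. cpoly q \<and> iter_deriv bs (gauss a c) = (\<lambda>x. q x * gauss a c x)"
proof (induction bs)
  case Nil
  show ?case by (rule exI[of _ "\<lambda>x. 1"]) (auto intro: cpoly.intros)
next
  case (Cons b bs)
  then obtain q where q: "cpoly q" "iter_deriv bs (gauss a c) = (\<lambda>x. q x * gauss a c x)" by blast
  obtain D where D: "\<And>x. (q has_derivative D x) (at x)" "\<And>v. cpoly (\<lambda>x. D x v)"
    using cpoly_has_derivative[OF q(1)] by blast
  let ?E = "\<lambda>x v. \<Sum>b\<in>Basis. c b * of_real (v \<bullet> b) - a b * (2 * of_real (x \<bullet> b) * of_real (v \<bullet> b))"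
  have "cpoly (\<lambda>x. \<Sum>i\<in>Basis. (c i * of_real (b \<bullet> i)) + (- 2 * a i * of_real (b \<bullet> i)) * of_real (x \<bullet> i))"
    by (intro cpoly_sum cpoly.intros)
  moreover have "(\<lambda>x. \<Sum>i\<in>Basis. (c i * of_real (b \<bullet> i)) + (- 2 * a i * of_real (b \<bullet> i)) * of_real (x \<bullet> i)) = (\<lambda>x. ?E x b)"
    by (intro ext sum.cong) auto
  ultimately have E: "cpoly (\<lambda>x. ?E x b)" by (simp only:)
  have "((\<lambda>x. q x * gauss a c x) has_derivative (\<lambda>v. q x * (?E x v * gauss a c x) + D x v * gauss a c x)) (at x)" for x
    by (rule has_derivative_mult[OF D(1) gauss_has_derivative])
  then have "frechet_derivative (\<lambda>x. q x * gauss a c x) (at x) = (\<lambda>v. q x * (?E x v * gauss a c x) + D x v * gauss a c x)" for x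
    by (rule frechet_derivative_at[symmetric])
  then have "iter_deriv (b # bs) (gauss a c) = (\<lambda>x. (q x * ?E x b + D x b) * gauss a c x)"
    by (simp add: q(2) fun_eq_iff distrib_right mult.assoc)
  moreover have "cpoly (\<lambda>x. q x * ?E x b + D x b)" by (intro cpoly.add cpoly.mult q(1) D(2) E)
  ultimately show ?case by blast
qed

lemma norm_gauss_le:
  fixes a c :: "'a::euclidean_space \<Rightarrow> complex"
  assumes "\<And>b. b \<in> Basis \<Longrightarrow> Re (a b) > 0"
  shows "\<exists>m \<delta>. \<delta> > 0 \<and> (\<forall>x. norm (gauss a c x) \<le> exp (m * norm x - \<delta> * (norm x)\<^sup>2))"
proof -
  define \<delta> where "\<delta> = Min ((\<lambda>b. Re (a b)) ` Basis)"
  have \<delta>: "\<delta> > 0" "\<And>b. b \<in> Basis \<Longrightarrow> \<delta> \<le> Re (a b)" using assms by (auto simp: \<delta>_def)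
  have "norm (gauss a c x) \<le> exp ((\<Sum>b\<in>Basis. \<bar>Re (c b)\<bar>) * norm x - \<delta> * (norm x)\<^sup>2)" for x
  proof -
    have "(\<Sum>b\<in>Basis. Re (c b) * (x \<bullet> b) - Re (a b) * (x \<bullet> b)\<^sup>2) \<le> (\<Sum>b\<in>Basis. \<bar>Re (c b)\<bar> * norm x - \<delta> * (x \<bullet> b)\<^sup>2)"
    proof (intro sum_mono diff_mono)
      fix b :: 'a assume b: "b \<in> Basis"
      have "Re (c b) * (x \<bullet> b) \<le> \<bar>Re (c b)\<bar> * \<bar>x \<bullet> b\<bar>" by (metis abs_ge_self abs_mult)
      also have "\<dots> \<le> \<bar>Re (c b)\<bar> * norm x" using b by (intro mult_left_mono Basis_le_norm) auto
      finally show "Re (c b) * (x \<bullet> b) \<le> \<bar>Re (c b)\<bar> * norm x" .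
      show "\<delta> * (x \<bullet> b)\<^sup>2 \<le> Re (a b) * (x \<bullet> b)\<^sup>2" using \<delta>(2)[OF b] by (intro mult_right_mono) auto
    qed
    also have "\<dots> = (\<Sum>b\<in>Basis. \<bar>Re (c b)\<bar>) * norm x - \<delta> * (norm x)\<^sup>2"
    proof -
      have "(norm x)\<^sup>2 = (\<Sum>b\<in>Basis. (x \<bullet> b)\<^sup>2)"
        unfolding power2_norm_eq_inner by (subst euclidean_inner) (simp add: power2_eq_square)
      then show ?thesis by (simp add: sum_subtractf sum_distrib_right sum_distrib_left)
    qed
    finally show ?thesis by (simp add: gauss_def)
  qed
  then show ?thesis using \<delta>(1) by blast
qed

lemma schwartz_gauss:
  fixes a c :: "'a::euclidean_space \<Rightarrow> complex"
  assumes "\<And>b. b \<in> Basis \<Longrightarrow> Re (a b) > 0"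
  shows "schwartz (gauss a c)"
  unfolding schwartz_def
proof (intro ballI conjI allI)
  fix bs :: "'a list"
  obtain q where q: "cpoly q" "iter_deriv bs (gauss a c) = (\<lambda>x. q x * gauss a c x)"
    using iter_deriv_gauss by blast
  obtain D where D: "\<And>x. (q has_derivative D x) (at x)" using cpoly_has_derivative[OF q(1)] by blast
  show "iter_deriv bs (gauss a c) differentiable (at x)" for x
    unfolding q(2) using has_derivative_mult[OF D gauss_has_derivative] by (auto intro: differentiableI)
  fix N :: nat
  obtain C where C: "\<And>x. norm (q x) \<le> C * exp (1 * norm x)" using cpoly_growth[OF q(1), of 1] by auto
  obtain m \<delta> where \<delta>: "\<delta> > 0" "\<And>x. norm (gauss a c x) \<le> exp (m * norm x - \<delta> * (norm x)\<^sup>2)"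
    using norm_gauss_le[where a = a and c = c, OF assms] by blast
  \<comment> \<open>Raise r \<le> (N + 1) exp (r / (N + 1)) to the power N; taking N + 1 instead of
    N includes N = 0.\<close>
  define B where "B = (real N + 1) ^ N"
  have pw: "r ^ N \<le> B * exp r" if "r \<ge> 0" for r :: real
  proof -
    have "r ^ N \<le> (1 / (1 / (real N + 1)) * exp (1 / (real N + 1) * r)) ^ N"
      using that by (intro power_mono le_exp_scaled) auto
    also have "\<dots> = B * exp (real N * (r / (real N + 1)))"
      unfolding exp_of_nat_mult by (simp add: B_def power_mult_distrib)
    also have "\<dots> \<le> B * exp r"
      using that by (intro mult_left_mono) (auto simp: B_def field_simps)
    finally show ?thesis .
  qed
  \<comment> \<open>The weight and the polynomial each cost one factor exp r, whence 2 + m. The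
    right-hand side is the maximum of exp ((2 + m) r - \<delta> r^2), found by completing the
    square.\<close>
  have "norm (norm x ^ N * norm (q x * gauss a c x)) \<le> B * C * exp ((2 + m)\<^sup>2 / (4 * \<delta>))" for x
  proof -
    have C0: "C \<ge> 0" using order_trans[OF norm_ge_zero C[of 0]] by simp
    have B0: "B \<ge> 0" by (simp add: B_def)
    define r where "r = norm x"
    have "norm (norm x ^ N * norm (q x * gauss a c x)) = norm x ^ N * (norm (q x) * norm (gauss a c x))"
      by (simp add: norm_mult)
    also have "\<dots> \<le> (B * exp r) * ((C * exp (1 * r)) * exp (m * r - \<delta> * r\<^sup>2))"
      unfolding r_def using B0 C0 by (intro mult_mono pw C \<delta>) auto
    also have "\<dots> = B * C * exp ((2 + m) * r - \<delta> * r\<^sup>2)"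
    proof -
      have "exp ((2 + m) * r - \<delta> * r\<^sup>2) = exp r * exp (1 * r) * exp (m * r - \<delta> * r\<^sup>2)"
        unfolding exp_add[symmetric] by (rule arg_cong[of _ _ exp]) (simp add: algebra_simps)
      then show ?thesis by (simp only: mult_ac)
    qed
    also have "(2 + m) * r - \<delta> * r\<^sup>2 \<le> (2 + m)\<^sup>2 / (4 * \<delta>)"
    proof -
      have "0 \<le> (2 * \<delta> * r - (2 + m))\<^sup>2" by simp
      then show ?thesis using \<delta>(1) by (simp add: field_simps power2_eq_square)
    qed
    finally show ?thesis using B0 C0 by (simp add: mult_left_mono)
  qed
  then show "bounded (range (\<lambda>x. norm x ^ N * norm (iter_deriv bs (gauss a c) x)))"
    unfolding q(2) by (intro boundedI) auto
qed

section \<open>Averages of Riesz means\<close>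

text \<open>Since t^\<alpha> (1 - s/t)_+^\<alpha> = (t - s)_+^\<alpha>, this is the Gamma integral
  translated by s, and the translation produces exp (- z s).\<close>

lemma riesz_kernel_Gamma:
  fixes z :: complex and s \<alpha> :: real
  assumes z: "Re z > 0" and s: "s \<ge> 0" and \<alpha>: "\<alpha> \<ge> 0"
  shows "has_bochner_integral lborel
     (\<lambda>t. of_real (indicator {0<..} t * t powr \<alpha>) * exp (- z * of_real t) * of_real (max 0 (1 - s / t) powr \<alpha>))
     (complex_of_real (Gamma (\<alpha> + 1)) * z powr (- of_real (\<alpha> + 1)) * exp (- z * of_real s))"
proof -
  have "has_bochner_integral lborel (\<lambda>t. of_real (indicator {0<..} t * t powr \<alpha>) * exp (- z * of_real t))
     (complex_of_real (Gamma (\<alpha> + 1)) * z powr (- of_real (\<alpha> + 1)))"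
    using has_bochner_integral_Gamma_complex[of "\<alpha> + 1" z] z \<alpha> by simp
  then have "has_bochner_integral lborel (\<lambda>t. of_real (indicator {0<..} (- s + 1 * t) * (- s + 1 * t) powr \<alpha>) * exp (- z * of_real (- s + 1 * t)))
     ((complex_of_real (Gamma (\<alpha> + 1)) * z powr (- of_real (\<alpha> + 1))) /\<^sub>R \<bar>1\<bar>)"
    by (subst (asm) lborel_has_bochner_integral_real_affine_iff[of 1 _ _ "- s"]) auto
  then have 1: "has_bochner_integral lborel (\<lambda>t. of_real (indicator {0<..} (- s + 1 * t) * (- s + 1 * t) powr \<alpha>) * exp (- z * of_real (- s + 1 * t)) * exp (- z * of_real s))
     ((complex_of_real (Gamma (\<alpha> + 1)) * z powr (- of_real (\<alpha> + 1))) /\<^sub>R \<bar>1\<bar> * exp (- z * of_real s))"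
    by (rule has_bochner_integral_mult_left)
  have 2: "of_real (indicator {0<..} (- s + 1 * t) * (- s + 1 * t) powr \<alpha>) * exp (- z * of_real (- s + 1 * t)) * exp (- z * of_real s)
    = of_real (indicator {0<..} t * t powr \<alpha>) * exp (- z * of_real t) * of_real (max 0 (1 - s / t) powr \<alpha>)" for t
  proof -
    have "exp (- z * of_real (- s + 1 * t)) * exp (- z * of_real s) = exp (- z * of_real t)"
      unfolding exp_add[symmetric] by (simp add: algebra_simps)
    \<comment> \<open>For t at most s both sides vanish, also when \<alpha> = 0, because
      \<open>0 powr 0 = 0\<close>.\<close>
    moreover have "indicator {0<..} (- s + 1 * t) * (- s + 1 * t) powr \<alpha> = indicator {0<..} t * t powr \<alpha> * max 0 (1 - s / t) powr \<alpha>"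
    proof (cases "t > s")
      case True
      then have "t > 0" "1 - s / t > 0" using s by auto
      then show ?thesis using True by (simp add: powr_mult[symmetric] right_diff_distrib)
    next
      case False
      then show ?thesis using s by (cases "t > 0") (auto simp: max_def)
    qed
    ultimately show ?thesis by (simp add: mult_ac)
  qed
  show ?thesis using 1 unfolding 2 by simp
qed

lemma integrable_lborel_pair_mult:
  fixes g :: "'a::euclidean_space \<Rightarrow> complex" and h :: "'b::euclidean_space \<Rightarrow> complex"
  assumes "integrable lborel g" "integrable lborel h"
  shows "integrable (lborel \<Otimes>\<^sub>M lborel) (\<lambda>(x, y). g x * h y)"
proof (rule lborel_pair.Fubini_integrable)
  have [measurable]: "g \<in> borel_measurable borel" "h \<in> borel_measurable borel"
    using assms[THEN borel_measurable_integrable] by auto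
  show "(\<lambda>(x, y). g x * h y) \<in> borel_measurable (lborel \<Otimes>\<^sub>M lborel)" by measurable
qed (use assms in \<open>auto simp: norm_mult\<close>)

text \<open>Fubini, followed by \<open>riesz_kernel_Gamma\<close> with s = |\<xi>|^2 for each
  frequency. The variable t stands for R^2.\<close>

lemma integral_riesz_means:
  fixes F :: "'a::euclidean_space \<Rightarrow> complex" and z :: complex
  assumes F: "integrable lborel F" and z: "Re z > 0" and \<alpha>: "\<alpha> \<ge> 0"
  shows "(LINT t|lborel. of_real (indicator {0<..} t * t powr \<alpha>) * exp (- z * of_real t)
            * (LINT \<xi>|lborel. of_real (max 0 (1 - (norm \<xi>)\<^sup>2 / t) powr \<alpha>) * F \<xi>))
    = complex_of_real (Gamma (\<alpha> + 1)) * z powr (- of_real (\<alpha> + 1)) * (LINT \<xi>|lborel. exp (- z * of_real ((norm \<xi>)\<^sup>2)) * F \<xi>)"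
proof -
  let ?k = "\<lambda>t. of_real (indicator {0<..} t * t powr \<alpha>) * exp (- z * of_real t)"
  let ?m = "\<lambda>t (\<xi>::'a). complex_of_real (max 0 (1 - (norm \<xi>)\<^sup>2 / t) powr \<alpha>)"
  have [measurable]: "F \<in> borel_measurable borel" using borel_measurable_integrable[OF F] by simp
  have k: "integrable lborel ?k"
    using has_bochner_integral_Gamma_complex[of "\<alpha> + 1" z] z \<alpha> by (simp add: has_bochner_integral_iff)
  have "integrable (lborel \<Otimes>\<^sub>M lborel) (\<lambda>(t, \<xi>). ?k t * F \<xi>)"
    by (rule integrable_lborel_pair_mult[OF k F])
  \<comment> \<open>The multiplier lies between 0 and 1 for positive t, so the product of the Gamma
    weight and F is an integrable majorant.\<close>
  then have int: "integrable (lborel \<Otimes>\<^sub>M lborel) (\<lambda>(t, \<xi>). ?k t * (?m t \<xi> * F \<xi>))"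
  proof (rule Bochner_Integration.integrable_bound)
    show "AE p in lborel \<Otimes>\<^sub>M lborel. norm (case p of (t, \<xi>) \<Rightarrow> ?k t * (?m t \<xi> * F \<xi>)) \<le> norm (case p of (t, \<xi>) \<Rightarrow> ?k t * F \<xi>)"
    proof (intro AE_I2, clarify)
      fix t :: real and \<xi> :: 'a
      show "norm (?k t * (?m t \<xi> * F \<xi>)) \<le> norm (?k t * F \<xi>)"
      proof (cases "t > 0")
        case True
        then have "max 0 (1 - (norm \<xi>)\<^sup>2 / t) powr \<alpha> \<le> 1 powr \<alpha>" using \<alpha> by (intro powr_mono2) auto
        then have "norm (?m t \<xi>) \<le> 1" by simp
        then have "norm (?m t \<xi>) * norm (F \<xi>) \<le> 1 * norm (F \<xi>)" by (intro mult_right_mono) auto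
        then show ?thesis unfolding norm_mult[of "?k t"] norm_mult[of "?m t \<xi>"] by (intro mult_left_mono) auto
      qed auto
    qed
  qed measurable
  have "(LINT t|lborel. ?k t * (LINT \<xi>|lborel. ?m t \<xi> * F \<xi>)) = (LINT t|lborel. (LINT \<xi>|lborel. ?k t * (?m t \<xi> * F \<xi>)))"
    by simp
  also have "\<dots> = (LINT \<xi>|lborel. (LINT t|lborel. ?k t * (?m t \<xi> * F \<xi>)))"
    by (rule lborel_pair.Fubini_integral[OF int, symmetric])
  also have "\<dots> = (LINT \<xi>|lborel. complex_of_real (Gamma (\<alpha> + 1)) * z powr (- of_real (\<alpha> + 1)) * exp (- z * of_real ((norm \<xi>)\<^sup>2)) * F \<xi>)"
  proof (intro Bochner_Integration.integral_cong refl)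
    fix \<xi> :: 'a
    have "(LINT t|lborel. ?k t * (?m t \<xi> * F \<xi>)) = (LINT t|lborel. ?k t * ?m t \<xi> * F \<xi>)" by (simp add: mult.assoc)
    also have "\<dots> = (LINT t|lborel. ?k t * ?m t \<xi>) * F \<xi>" by simp
    also have "(LINT t|lborel. ?k t * ?m t \<xi>) = complex_of_real (Gamma (\<alpha> + 1)) * z powr (- of_real (\<alpha> + 1)) * exp (- z * of_real ((norm \<xi>)\<^sup>2))"
      using riesz_kernel_Gamma[OF z _ \<alpha>, of "(norm \<xi>)\<^sup>2"] by (simp add: has_bochner_integral_iff)
    finally show "(LINT t|lborel. ?k t * (?m t \<xi> * F \<xi>)) = complex_of_real (Gamma (\<alpha> + 1)) * z powr (- of_real (\<alpha> + 1)) * exp (- z * of_real ((norm \<xi>)\<^sup>2)) * F \<xi>" .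
  qed
  also have "\<dots> = complex_of_real (Gamma (\<alpha> + 1)) * z powr (- of_real (\<alpha> + 1)) * (LINT \<xi>|lborel. exp (- z * of_real ((norm \<xi>)\<^sup>2)) * F \<xi>)"
    by (simp add: mult.assoc)
  finally show ?thesis .
qed

text \<open>The continuous Dirichlet kernel 2 sin (a s) / s. It stays in integral form because
  Fubini delivers it so and s = 0 is then no exception.\<close>

definition dirichlet :: "real \<Rightarrow> real \<Rightarrow> complex" where
  "dirichlet a s = (LINT v|lborel. indicator {-a..a} v * exp (- \<i> * of_real (v * s)))"

lemma norm_dirichlet_le_length:
  assumes "a \<ge> 0"
  shows "norm (dirichlet a s) \<le> 2 * a"
proof -
  have "norm (indicator {-a..a} v * exp (- \<i> * of_real (v * s)) :: complex) = indicator {-a..a} v" for v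
    by (simp add: norm_mult indicator_def)
  then have "norm (dirichlet a s) \<le> (LINT v|lborel. indicator {-a..a} v)"
    unfolding dirichlet_def by (intro order_trans[OF integral_norm_bound]) (simp only: order_refl)
  then show ?thesis using assms by simp
qed

text \<open>This is where the average over v gains: with the v-integral done first, its oscillation
  becomes the kernel \<open>dirichlet\<close> centred at t0, while the factor exp (- i \<tau> t) has
  modulus 1 and disappears. Bounding the integral for each v separately would cost the full length
  2a.\<close>

lemma norm_averaged_integral_le:
  fixes b :: "real \<Rightarrow> complex" and \<tau> \<alpha> a t0 B :: real
  assumes [measurable]: "b \<in> borel_measurable borel" and B: "\<And>t. t > 0 \<Longrightarrow> norm (b t) \<le> B" and \<alpha>: "\<alpha> \<ge> 0"
  shows "norm (LINT v|lborel. indicator {-a..a} v * exp (\<i> * of_real (v * t0)) *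
            (LINT t|lborel. of_real (indicator {0<..} t * t powr \<alpha>) * exp (- (1 + \<i> * of_real (\<tau> + v)) * of_real t) * b t))
    \<le> B * (LINT t|lborel. indicator {0<..} t * t powr \<alpha> * exp (- t) * norm (dirichlet a (t - t0)))"
proof -
  let ?g = "\<lambda>v. indicator {-a..a} v :: complex"
  let ?k = "\<lambda>t. of_real (indicator {0<..} t * t powr \<alpha> * exp (- t)) :: complex"
  let ?h = "\<lambda>v t. ?g v * (exp (- \<i> * of_real (v * (t - t0))) * (?k t * exp (- \<i> * of_real (\<tau> * t)) * b t))"
  have B0: "B \<ge> 0" using B[of 1] norm_ge_zero[of "b 1"] by linarith
  have g: "integrable lborel (\<lambda>v. ?g v * B)" 
  proof -
    have "integrable lborel (\<lambda>v. complex_of_real (indicator {-a..a} v * B))"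
      by (intro integrable_of_real integrable_mult_left integrable_real_indicator) (auto simp: emeasure_lborel_Icc_eq)
    then show ?thesis by (simp add: of_real_indicator)
  qed
  have kr: "integrable lborel (\<lambda>t. indicator {0<..} t * t powr \<alpha> * exp (- t))"
    using has_bochner_integral_Gamma_real[of "\<alpha> + 1" 1] \<alpha> by (simp add: has_bochner_integral_iff)
  then have k: "integrable lborel ?k" by (rule integrable_of_real)
  have nb: "norm (?k t * exp (- \<i> * of_real (\<tau> * t)) * b t) \<le> (indicator {0<..} t * t powr \<alpha> * exp (- t)) * B" for t
    using B[of t] by (cases "t > 0") (auto simp: norm_mult intro!: mult_left_mono)
  have int: "integrable (lborel \<Otimes>\<^sub>M lborel) (\<lambda>(v, t). ?h v t)"
  proof (rule Bochner_Integration.integrable_bound[OF integrable_lborel_pair_mult[OF g k]])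
    show "AE p in lborel \<Otimes>\<^sub>M lborel. norm (case p of (v, t) \<Rightarrow> ?h v t) \<le> norm (case p of (v, t) \<Rightarrow> ?g v * of_real B * ?k t)"
    proof (intro AE_I2, clarify)
      fix v t :: real
      have "norm (?h v t) = norm (?g v) * norm (?k t * exp (- \<i> * of_real (\<tau> * t)) * b t)"
        unfolding norm_mult[of "?g v"] norm_mult[of "exp (- \<i> * of_real (v * (t - t0)))"] by simp
      also have "\<dots> \<le> norm (?g v) * ((indicator {0<..} t * t powr \<alpha> * exp (- t)) * B)"
        by (intro mult_left_mono nb) auto
      also have "\<dots> = norm (?g v * of_real B * ?k t)" using B0 by (simp add: norm_mult abs_mult)
      finally show "norm (?h v t) \<le> norm (?g v * of_real B * ?k t)" .
    qed
  qed measurable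
  have "(LINT v|lborel. ?g v * exp (\<i> * of_real (v * t0)) *
            (LINT t|lborel. of_real (indicator {0<..} t * t powr \<alpha>) * exp (- (1 + \<i> * of_real (\<tau> + v)) * of_real t) * b t))
      = (LINT v|lborel. (LINT t|lborel. ?h v t))"
  proof (intro Bochner_Integration.integral_cong refl)
    fix v :: real
    have "?g v * exp (\<i> * of_real (v * t0)) * (of_real (indicator {0<..} t * t powr \<alpha>) * exp (- (1 + \<i> * of_real (\<tau> + v)) * of_real t) * b t) = ?h v t" for t
    proof -
      have "exp (\<i> * of_real (v * t0)) * exp (- (1 + \<i> * of_real (\<tau> + v)) * of_real t)
        = exp (- \<i> * of_real (v * (t - t0))) * exp (of_real (- t)) * exp (- \<i> * of_real (\<tau> * t))"
        unfolding exp_add[symmetric] by (rule arg_cong[of _ _ exp]) (simp add: algebra_simps)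
      then show ?thesis unfolding exp_of_real by (simp add: mult_ac)
    qed
    then show "?g v * exp (\<i> * of_real (v * t0)) * (LINT t|lborel. of_real (indicator {0<..} t * t powr \<alpha>) * exp (- (1 + \<i> * of_real (\<tau> + v)) * of_real t) * b t) = (LINT t|lborel. ?h v t)"
      by (simp only: integral_mult_right_zero[symmetric])
  qed
  also have "\<dots> = (LINT t|lborel. (LINT v|lborel. ?h v t))"
    by (rule lborel_pair.Fubini_integral[OF int, symmetric])
  also have "\<dots> = (LINT t|lborel. dirichlet a (t - t0) * (?k t * exp (- \<i> * of_real (\<tau> * t)) * b t))"
    unfolding dirichlet_def by (simp add: mult.assoc[symmetric])
  finally have eq: "(LINT v|lborel. ?g v * exp (\<i> * of_real (v * t0)) *
            (LINT t|lborel. of_real (indicator {0<..} t * t powr \<alpha>) * exp (- (1 + \<i> * of_real (\<tau> + v)) * of_real t) * b t))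
     = (LINT t|lborel. dirichlet a (t - t0) * (?k t * exp (- \<i> * of_real (\<tau> * t)) * b t))" .
  have [measurable]: "dirichlet a \<in> borel_measurable borel"
    unfolding dirichlet_def[abs_def] by measurable
  \<comment> \<open>For negative a the interval is empty and the kernel is 0.\<close>
  have D: "norm (dirichlet a s) \<le> 2 * \<bar>a\<bar>" for s
    using norm_dirichlet_le_length[of "\<bar>a\<bar>" s]
    by (cases "a \<ge> 0") (auto simp: dirichlet_def)
  have "integrable lborel (\<lambda>t. (indicator {0<..} t * t powr \<alpha> * exp (- t)) * norm (dirichlet a (t - t0)))"
    using D by (intro integrable_real_mult_indicator Bochner_Integration.integrable_bound[OF integrable_mult_left[OF kr, of "2 * \<bar>a\<bar>"]] AE_I2)
      (auto simp: abs_mult intro!: mult_left_mono)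
  then have i2: "integrable lborel (\<lambda>t. B * (indicator {0<..} t * t powr \<alpha> * exp (- t) * norm (dirichlet a (t - t0))))"
    by (rule integrable_mult_right)
  have "norm (LINT t|lborel. dirichlet a (t - t0) * (?k t * exp (- \<i> * of_real (\<tau> * t)) * b t))
    \<le> (LINT t|lborel. B * (indicator {0<..} t * t powr \<alpha> * exp (- t) * norm (dirichlet a (t - t0))))"
  proof (rule Bochner_Integration.integral_norm_bound_integral[OF _ i2])
    fix t
    have "norm (dirichlet a (t - t0) * (?k t * exp (- \<i> * of_real (\<tau> * t)) * b t))
      \<le> norm (dirichlet a (t - t0)) * ((indicator {0<..} t * t powr \<alpha> * exp (- t)) * B)"
      unfolding norm_mult[of "dirichlet a (t - t0)"] by (intro mult_left_mono nb) auto
    then show le: "norm (dirichlet a (t - t0) * (?k t * exp (- \<i> * of_real (\<tau> * t)) * b t)) \<le> B * (indicator {0<..} t * t powr \<alpha> * exp (- t) * norm (dirichlet a (t - t0)))"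
      by (simp only: mult_ac)
  next
    show "integrable lborel (\<lambda>t. dirichlet a (t - t0) * (?k t * exp (- \<i> * of_real (\<tau> * t)) * b t))"
    proof (rule Bochner_Integration.integrable_bound[OF i2], measurable, intro AE_I2)
      fix t
      have "norm (dirichlet a (t - t0) * (?k t * exp (- \<i> * of_real (\<tau> * t)) * b t))
        \<le> norm (dirichlet a (t - t0)) * ((indicator {0<..} t * t powr \<alpha> * exp (- t)) * B)"
        unfolding norm_mult[of "dirichlet a (t - t0)"] by (intro mult_left_mono nb) auto
      then show "norm (dirichlet a (t - t0) * (?k t * exp (- \<i> * of_real (\<tau> * t)) * b t)) \<le> norm (B * (indicator {0<..} t * t powr \<alpha> * exp (- t) * norm (dirichlet a (t - t0))))"
        by (simp only: mult_ac real_norm_def)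
    qed
  qed
  then show ?thesis unfolding eq by simp
qed

lemma norm_dirichlet_le_inverse:
  assumes a: "a \<ge> 0" and s: "s \<noteq> 0"
  shows "norm (dirichlet a s) \<le> 2 / \<bar>s\<bar>"
proof -
  let ?F = "\<lambda>v. exp (- \<i> * of_real (v * s)) / (- \<i> * of_real s)"
  have "(LINT v|lborel. indicator {-a..a} v *\<^sub>R exp (- \<i> * of_real (v * s))) = ?F a - ?F (- a)"
  proof (rule integral_FTC_atLeastAtMost)
    show "(?F has_vector_derivative exp (- \<i> * of_real (v * s))) (at v within {-a..a})" for v
    proof -
      have "((\<lambda>z. exp (- \<i> * (z * of_real s)) / (- \<i> * of_real s)) has_field_derivative exp (- \<i> * (of_real v * of_real s))) (at (of_real v))"
        using s by (auto intro!: derivative_eq_intros simp: mult.commute[of "exp _" "\<i>"])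
      from has_vector_derivative_real_field[OF this] show ?thesis by simp
    qed
    show "continuous_on {- a..a} (\<lambda>v. exp (- \<i> * complex_of_real (v * s)))" by (intro continuous_intros)
  qed (use a in auto)
  then have "dirichlet a s = ?F a - ?F (- a)"
    unfolding dirichlet_def by (simp add: scaleR_conv_of_real of_real_indicator)
  also have "norm \<dots> \<le> norm (?F a) + norm (?F (- a))" by (rule norm_triangle_ineq4)
  also have "\<dots> = 2 / \<bar>s\<bar>" by (simp add: norm_divide norm_mult)
  finally show ?thesis .
qed

text \<open>The maximum is at t = \<alpha>; the cruder constant with \<alpha> + 1 also covers
  \<alpha> = 0.\<close>

lemma powr_mult_exp_minus_le:
  fixes t \<alpha> :: real
  assumes "t > 0" "\<alpha> \<ge> 0"
  shows "t powr \<alpha> * exp (- t) \<le> (\<alpha> + 1) powr \<alpha>"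
proof -
  have "t \<le> (\<alpha> + 1) * exp (t / (\<alpha> + 1))"
    using le_exp_scaled[of "1 / (\<alpha> + 1)" t] assms by simp
  then have "t powr \<alpha> \<le> ((\<alpha> + 1) * exp (t / (\<alpha> + 1))) powr \<alpha>"
    using assms by (intro powr_mono2) auto
  also have "\<dots> = (\<alpha> + 1) powr \<alpha> * exp (\<alpha> * (t / (\<alpha> + 1)))"
    using assms by (simp add: powr_mult exp_powr_real mult.commute)
  also have "\<alpha> * (t / (\<alpha> + 1)) \<le> t"
    using assms by (simp add: field_simps)
  finally have "t powr \<alpha> \<le> (\<alpha> + 1) powr \<alpha> * exp t"
    by (simp add: mult_left_mono)
  then have "t powr \<alpha> * exp (- t) \<le> (\<alpha> + 1) powr \<alpha> * exp t * exp (- t)"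
    by (intro mult_right_mono) auto
  then show ?thesis by (simp add: mult.assoc exp_minus)
qed

text \<open>Near 0 the minimum of 2a and 2/|s| is at most 4 / (1/a + |s|), the crossover being at
  |s| = 1/a. Separating the signs of s leaves functions with an elementary antiderivative; the
  constant 2 serves for |s| > 1.\<close>

lemma norm_dirichlet_le_sum:
  assumes a: "a > 0"
  shows "norm (dirichlet a s) \<le> 2 + 4 * (indicator {0..1} s / (1/a + s) + indicator {0..1} (- s) / (1/a - s))"
proof -
  have nn: "0 \<le> indicator {0..1} s / (1/a + s)" "0 \<le> indicator {0..1} (- s) / (1/a - s)"
    using a by (auto simp: indicator_def intro: order_trans[of s 0])
  consider "\<bar>s\<bar> > 1" | "\<bar>s\<bar> \<le> 1" "\<bar>s\<bar> > 1/a" | "\<bar>s\<bar> \<le> 1" "\<bar>s\<bar> \<le> 1/a" by linarith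
  then show ?thesis
  proof cases
    case 1
    then have "norm (dirichlet a s) \<le> 2 / \<bar>s\<bar>" using a by (intro norm_dirichlet_le_inverse) auto
    also have "\<dots> \<le> 2" using 1 by (simp add: field_simps)
    finally have "norm (dirichlet a s) \<le> 2 + 4 * (x + y)" if "0 \<le> x" "0 \<le> y" for x y :: real
      using that unfolding distrib_left by linarith
    from this[OF nn] show ?thesis .
  next
    case 2
    have p: "1 / a > 0" using a by simp
    have "s \<noteq> 0" using 2(2) p by auto
    then have "norm (dirichlet a s) \<le> 2 / \<bar>s\<bar>" using a by (intro norm_dirichlet_le_inverse) auto
    also have "\<dots> \<le> 4 * (1 / (1/a + \<bar>s\<bar>))"
    proof -
      have "1/a + \<bar>s\<bar> \<le> 2 * \<bar>s\<bar>" using 2 by linarith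
      then have "2 / (2 * \<bar>s\<bar>) \<le> 2 / (1/a + \<bar>s\<bar>)" using p \<open>s \<noteq> 0\<close> by (intro divide_left_mono mult_pos_pos add_pos_nonneg) auto
      then show ?thesis by simp
    qed
    also have "1 / (1/a + \<bar>s\<bar>) \<le> indicator {0..1} s / (1/a + s) + indicator {0..1} (- s) / (1/a - s)"
      using 2 nn by (cases "s \<ge> 0") (auto simp: indicator_def)
    finally show ?thesis by simp
  next
    case 3
    have p: "1 / a > 0" using a by simp
    have "norm (dirichlet a s) \<le> 2 * a" using a by (intro norm_dirichlet_le_length) auto
    also have "\<dots> \<le> 4 * (1 / (1/a + \<bar>s\<bar>))"
    proof -
      have "4 / (2 / a) \<le> 4 / (1/a + \<bar>s\<bar>)" using p 3 a by (intro divide_left_mono mult_pos_pos add_pos_nonneg) auto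
      then show ?thesis by simp
    qed
    also have "1 / (1/a + \<bar>s\<bar>) \<le> indicator {0..1} s / (1/a + s) + indicator {0..1} (- s) / (1/a - s)"
      using 3 nn by (cases "s \<ge> 0") (auto simp: indicator_def)
    finally show ?thesis by simp
  qed
qed

lemma has_bochner_integral_inverse_shift:
  fixes a :: real
  assumes a: "a > 0"
  shows "has_bochner_integral lborel (\<lambda>s. indicator {0..1} s / (1/a + s)) (ln (1 + a))"
proof -
  have p: "1 / a + s > 0" if "s \<ge> 0" for s using a that by (intro add_pos_nonneg) auto
  have cont: "continuous_on {0..1} (\<lambda>s. 1 / (1/a + s))"
    using p by (intro continuous_intros) (auto simp: less_le)
  have "(LINT s|lborel. indicator {0..1} s *\<^sub>R (1 / (1/a + s))) = ln (1/a + 1) - ln (1/a + 0)"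
  proof (rule integral_FTC_atLeastAtMost)
    show "((\<lambda>s. ln (1/a + s)) has_vector_derivative 1 / (1/a + s)) (at s within {0..1})" if "0 \<le> s" "s \<le> 1" for s
      using p[OF that(1)]
      by (auto intro!: derivative_eq_intros simp: has_real_derivative_iff_has_vector_derivative[symmetric])
  qed (use cont in auto)
  also have "\<dots> = ln (1 + a)"
  proof -
    have "1/a + 1 = (1 + a) / a" using a by (simp add: field_simps)
    then show ?thesis using a by (simp add: ln_div)
  qed
  finally show ?thesis
    using borel_integrable_atLeastAtMost'[OF cont] by (simp add: has_bochner_integral_iff set_integrable_def)
qed

text \<open>The kernel itself is not absolutely integrable over the line. Far from t0 the total mass
  of the Gamma weight is used, near t0 the supremum of the weight and the logarithmic integral of
  the kernel. Neither depends on t0, hence the uniform constant.\<close>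

lemma weighted_dirichlet_bound:
  fixes \<alpha> :: real
  assumes \<alpha>: "\<alpha> \<ge> 0"
  obtains C where "C > 0"
    "\<And>a t0. a > 0 \<Longrightarrow> (LINT t|lborel. indicator {0<..} t * t powr \<alpha> * exp (- t) * norm (dirichlet a (t - t0))) \<le> C * (1 + ln (1 + a))"
proof
  define H where "H = (\<alpha> + 1) powr \<alpha>"
  define C where "C = 2 * Gamma (\<alpha> + 1) + 8 * H"
  have G: "Gamma (\<alpha> + 1) > 0" using \<alpha> by (intro Gamma_real_pos) auto
  have H: "H > 0" using \<alpha> by (simp add: H_def)
  show "C > 0" using G H by (simp add: C_def)
  fix a t0 :: real assume a: "a > 0"
  let ?k = "\<lambda>t. indicator {0<..} t * t powr \<alpha> * exp (- t) :: real"
  let ?\<phi> = "\<lambda>s. indicator {0..1} s / (1/a + s) :: real"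
  have k: "has_bochner_integral lborel ?k (Gamma (\<alpha> + 1))"
    using has_bochner_integral_Gamma_real[of "\<alpha> + 1" 1] \<alpha> by simp
  have 1: "has_bochner_integral lborel (\<lambda>t. ?\<phi> (- t0 + 1 * t)) (ln (1 + a) /\<^sub>R \<bar>1\<bar>)"
    using has_bochner_integral_inverse_shift[OF a] by (subst (asm) lborel_has_bochner_integral_real_affine_iff[of 1 _ _ "- t0"]) auto
  have 2: "has_bochner_integral lborel (\<lambda>t. ?\<phi> (t0 + (- 1) * t)) (ln (1 + a) /\<^sub>R \<bar>- 1\<bar>)"
    using has_bochner_integral_inverse_shift[OF a] by (subst (asm) lborel_has_bochner_integral_real_affine_iff[of "- 1" _ _ t0]) auto
  have 3: "has_bochner_integral lborel (\<lambda>t. ?k t * 2 + 4 * H * (?\<phi> (- t0 + 1 * t) + ?\<phi> (t0 + (- 1) * t)))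
      (Gamma (\<alpha> + 1) * 2 + 4 * H * (ln (1 + a) /\<^sub>R \<bar>1\<bar> + ln (1 + a) /\<^sub>R \<bar>- 1\<bar>))"
    by (intro has_bochner_integral_add has_bochner_integral_mult_left has_bochner_integral_mult_right k 1 2)
  have "(LINT t|lborel. ?k t * norm (dirichlet a (t - t0))) \<le> (LINT t|lborel. ?k t * 2 + 4 * H * (?\<phi> (- t0 + 1 * t) + ?\<phi> (t0 + (- 1) * t)))"
  proof (rule integral_mono')
    fix t
    have nn: "0 \<le> ?\<phi> (- t0 + 1 * t)" "0 \<le> ?\<phi> (t0 + (- 1) * t)" "0 \<le> ?k t" using a by (auto simp: indicator_def)
    have kH: "?k t \<le> H"
      using powr_mult_exp_minus_le[of t \<alpha>] \<alpha> H by (auto simp: indicator_def H_def)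
    have "?k t * norm (dirichlet a (t - t0)) \<le> ?k t * (2 + 4 * (?\<phi> (- t0 + 1 * t) + ?\<phi> (t0 + (- 1) * t)))"
      using norm_dirichlet_le_sum[OF a, of "t - t0"] nn(3) by (intro mult_left_mono) (auto simp: algebra_simps)
    also have "\<dots> = ?k t * 2 + ?k t * (4 * (?\<phi> (- t0 + 1 * t) + ?\<phi> (t0 + (- 1) * t)))" by (rule distrib_left)
    also have "\<dots> \<le> ?k t * 2 + H * (4 * (?\<phi> (- t0 + 1 * t) + ?\<phi> (t0 + (- 1) * t)))"
      using nn kH by (intro add_left_mono mult_right_mono) auto
    finally show "?k t * norm (dirichlet a (t - t0)) \<le> ?k t * 2 + 4 * H * (?\<phi> (- t0 + 1 * t) + ?\<phi> (t0 + (- 1) * t))"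
      by (simp only: mult_ac)
    show "0 \<le> ?k t * 2 + 4 * H * (?\<phi> (- t0 + 1 * t) + ?\<phi> (t0 + (- 1) * t))"
      using nn H by (intro add_nonneg_nonneg mult_nonneg_nonneg) auto
  qed (use 3 in \<open>simp add: has_bochner_integral_iff\<close>)
  also have "\<dots> = 2 * Gamma (\<alpha> + 1) + 8 * H * ln (1 + a)"
    using 3 by (simp add: has_bochner_integral_iff)
  also have "\<dots> \<le> C * (1 + ln (1 + a))"
  proof -
    have "0 \<le> Gamma (\<alpha> + 1) * ln (1 + a)" "H \<ge> 0" using a G H by (auto intro!: mult_nonneg_nonneg)
    then show ?thesis by (simp add: C_def algebra_simps)
  qed
  finally show "(LINT t|lborel. ?k t * norm (dirichlet a (t - t0))) \<le> C * (1 + ln (1 + a))" .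
qed

section \<open>Stationary phase\<close>

text \<open>Mean value inequality on a convex region that avoids the branch cut and on which the
  derivative 1/z is at most 1/\<mu> in modulus.\<close>

lemma norm_Ln_increment_le:
  fixes w :: complex and v \<mu> :: real
  assumes "Re w > 0" "\<mu> > 0" "Im w \<ge> \<mu>" "Im w + v \<ge> \<mu>"
  shows "norm (Ln (w + \<i> * of_real v) - Ln w) \<le> \<bar>v\<bar> / \<mu>"
proof -
  let ?S = "{z. Re z > 0} \<inter> {z. Im z \<ge> \<mu>}"
  have "norm (Ln (w + \<i> * of_real v) - Ln w) \<le> 1 / \<mu> * norm (w + \<i> * of_real v - w)"
  proof (rule field_differentiable_bound[of ?S Ln inverse])
    show "convex ?S" by (intro convex_Int convex_halfspace_Re_gt convex_halfspace_Im_ge)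
    fix z assume "z \<in> ?S"
    then have z: "Re z > 0" "Im z \<ge> \<mu>" by simp_all
    have "z \<notin> \<real>\<^sub>\<le>\<^sub>0" using z(1) by (simp add: complex_nonpos_Reals_iff)
    then show "(Ln has_field_derivative inverse z) (at z within ?S)"
      by (rule has_field_derivative_at_within[OF has_field_derivative_Ln])
    have "\<mu> \<le> norm z" using z(2) abs_Im_le_cmod[of z] by linarith
    then have "inverse (norm z) \<le> inverse \<mu>" using \<open>\<mu> > 0\<close> by (rule le_imp_inverse_le)
    then show "norm (inverse z) \<le> 1 / \<mu>" by (simp only: norm_inverse) (simp only: inverse_eq_divide)
  next
    show "w \<in> ?S" "w + \<i> * of_real v \<in> ?S" using assms by simp_all
  qed
  then show ?thesis by (simp add: norm_mult)
qed

text \<open>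
  The logarithm of the \<open>v\<close>-dependent part of the propagated plate at \<open>z = 1 + i(Y + v)\<close>, with \<open>\<kappa> = k\<close>,
  \<open>\<nu> = n - 1\<close>, \<open>M = m + 1\<close>, \<open>Y = \<pi> x\<^sub>1\<close> and \<open>q = \<pi>\<^sup>2 |x'|\<^sup>2\<close>. The last summand is the modulation that cancels
  the first-order term of the rest, up to \<open>O(v/M)\<close>.
\<close>

definition phase :: "real \<Rightarrow> real \<Rightarrow> real \<Rightarrow> real \<Rightarrow> real \<Rightarrow> real \<Rightarrow> real \<Rightarrow> complex" where
  "phase \<kappa> \<nu> \<alpha> M q Y v = - of_real (\<alpha> + 1) * Ln (1 + \<i> * of_real (Y + v))
     + of_real \<kappa> * (- (1/2) * Ln (of_real M + \<i> * of_real (Y + v)) - of_real (\<nu> / 2) * Ln (2 + \<i> * of_real (Y + v))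
        + (of_real M + \<i> * of_real Y)\<^sup>2 / (of_real M + \<i> * of_real (Y + v)) - of_real q / (2 + \<i> * of_real (Y + v)))
     + \<i> * of_real (v * (\<kappa> * (1 + q / Y\<^sup>2)))"

text \<open>Because A^2 = (A + iv)(A - iv) - v^2, the remainder is exactly - v^2 / (A + iv). It is
  this term that limits v to the order M^(1/2).\<close>

lemma phase_increment_quadratic:
  fixes A :: complex and v M :: real
  assumes "M > 0" "Re A = M"
  shows "norm (A\<^sup>2 / (A + \<i> * of_real v) - A + \<i> * of_real v) \<le> v\<^sup>2 / M"
proof -
  let ?D = "A + \<i> * of_real v"
  have "M \<le> norm ?D" using abs_Re_le_cmod[of ?D] assms by simp
  then have D: "norm ?D \<ge> M" "?D \<noteq> 0" using assms by auto
  have "A\<^sup>2 / ?D - A + \<i> * of_real v = - (of_real v)\<^sup>2 / ?D"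
    using D(2) by (simp add: field_simps power2_eq_square)
  then have "norm (A\<^sup>2 / ?D - A + \<i> * of_real v) = v\<^sup>2 / norm ?D"
    by (simp add: norm_divide norm_power)
  also have "\<dots> \<le> v\<^sup>2 / M" using D(1) assms by (intro divide_left_mono mult_pos_pos) auto
  finally show ?thesis .
qed

text \<open>Here q may be as large as M^2, so the first-order term has to cancel. The product of the
  two denominators is close to - Y^2, and the sum of Y^2 and this product is only O(M (1 + |v|))
  instead of O(M^2).\<close>

lemma phase_increment_transversal:
  fixes q v M Y \<nu> :: real
  assumes M: "M \<ge> 2" and Y: "M \<le> Y" "Y \<le> 2 * M" and q: "0 \<le> q" "q \<le> \<nu> * M\<^sup>2" and v: "\<bar>v\<bar> \<le> M / 2"
  shows "norm (- (of_real q / (2 + \<i> * of_real (Y + v))) + of_real q / (2 + \<i> * of_real Y) + \<i> * of_real (v * (q / Y\<^sup>2)))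
     \<le> \<nu> * (26 * \<bar>v\<bar> + 4 * v\<^sup>2) / M"
proof -
  define B :: complex where "B = 2 + \<i> * of_real Y"
  let ?D = "2 + \<i> * of_real (Y + v)"
  have Y0: "Y > 0" using M Y by simp
  have \<nu>: "\<nu> \<ge> 0" using order_trans[OF q] M by (simp add: zero_le_mult_iff)
  have nB: "norm B \<ge> M" using abs_Im_le_cmod[of B] Y M by (simp add: B_def)
  have nD: "norm ?D \<ge> M / 2" using abs_Im_le_cmod[of ?D] Y v by simp
  have B0: "B \<noteq> 0" and D0: "?D \<noteq> 0" using nB nD M by auto
  have eq: "- (of_real q / ?D) + of_real q / B + \<i> * of_real (v * (q / Y\<^sup>2))
    = \<i> * of_real v * of_real q * ((of_real Y)\<^sup>2 + B * ?D) / (B * ?D * (of_real Y)\<^sup>2)"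
  proof -
    have sum: "w / p + w / y = w * (y + p) / (p * y)" if "p \<noteq> 0" "y \<noteq> 0" for w p y :: complex
      using that by (simp add: field_simps)
    have "- (of_real q / ?D) + of_real q / B = of_real q * (?D - B) / (B * ?D)"
      using B0 D0 by (simp add: diff_divide_distrib right_diff_distrib)
    also have "?D - B = \<i> * of_real v" by (simp add: B_def algebra_simps)
    finally have "- (of_real q / ?D) + of_real q / B + \<i> * of_real (v * (q / Y\<^sup>2))
      = \<i> * of_real v * of_real q / (B * ?D) + \<i> * of_real v * of_real q / (of_real Y)\<^sup>2"
      by (simp add: mult_ac)
    also have "\<dots> = \<i> * of_real v * of_real q * ((of_real Y)\<^sup>2 + B * ?D) / (B * ?D * (of_real Y)\<^sup>2)"
      using B0 D0 Y0 by (intro sum) auto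
    finally show ?thesis .
  qed
  have num: "(of_real Y)\<^sup>2 + B * ?D = of_real (4 - Y * v) + \<i> * of_real (4 * Y + 2 * v)"
    by (simp add: B_def algebra_simps power2_eq_square)
  have n1: "norm ((of_real Y)\<^sup>2 + B * ?D) \<le> (13 + 2 * \<bar>v\<bar>) * M"
  proof -
    have "norm ((of_real Y)\<^sup>2 + B * ?D) \<le> \<bar>4 - Y * v\<bar> + \<bar>4 * Y + 2 * v\<bar>"
      unfolding num by (rule order_trans[OF norm_triangle_ineq]) (simp add: norm_mult del: of_real_add of_real_diff of_real_mult)
    also have "\<dots> \<le> 4 + Y * \<bar>v\<bar> + (4 * Y + 2 * \<bar>v\<bar>)"
      using Y0 abs_triangle_ineq4[of 4 "Y * v"] by (simp add: abs_mult)
    also have "Y * \<bar>v\<bar> \<le> (2 * M) * \<bar>v\<bar>" using Y by (intro mult_right_mono) auto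
    finally show ?thesis using M Y v by (simp add: algebra_simps)
  qed
  have "norm (\<i> * of_real v * of_real q * ((of_real Y)\<^sup>2 + B * ?D) / (B * ?D * (of_real Y)\<^sup>2))
    = \<bar>v\<bar> * q * norm ((of_real Y)\<^sup>2 + B * ?D) / (norm B * norm ?D * Y\<^sup>2)"
    using q by (simp add: norm_mult norm_divide norm_power del: of_real_add)
  also have "\<dots> \<le> \<bar>v\<bar> * (\<nu> * M\<^sup>2) * ((13 + 2 * \<bar>v\<bar>) * M) / (M * (M / 2) * M\<^sup>2)"
  proof (rule frac_le)
    show "\<bar>v\<bar> * q * norm ((of_real Y)\<^sup>2 + B * ?D) \<le> \<bar>v\<bar> * (\<nu> * M\<^sup>2) * ((13 + 2 * \<bar>v\<bar>) * M)"
      using q \<nu> by (intro mult_mono n1 mult_nonneg_nonneg) auto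
    show "0 \<le> \<bar>v\<bar> * (\<nu> * M\<^sup>2) * ((13 + 2 * \<bar>v\<bar>) * M)"
      using \<nu> M by (intro mult_nonneg_nonneg) auto
    show "0 < M * (M / 2) * M\<^sup>2" using M by simp
    show "M * (M / 2) * M\<^sup>2 \<le> norm B * norm ?D * Y\<^sup>2"
      using M Y nB nD by (intro mult_mono power_mono mult_nonneg_nonneg) auto
  qed
  also have "\<dots> = \<nu> * (26 * \<bar>v\<bar> + 4 * v\<^sup>2) / M"
  proof -
    have "\<bar>v\<bar> * \<bar>v\<bar> = v\<^sup>2" by (simp add: power2_eq_square)
    then show ?thesis using M by (simp add: field_simps power2_eq_square)
  qed
  finally show ?thesis unfolding eq[unfolded B_def] B_def by (simp only: B_def)
qed

text \<open>With |v| a small multiple of M^(1/2) the right-hand side is a small constant. The number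
  31 = 27 + 4 majorizes the coefficients 27 of \<nu> |v| (1 from a logarithm, 26 from the
  transversal term) and 4 of \<nu> v^2.\<close>

lemma phase_increment:
  fixes \<kappa> \<nu> \<alpha> :: real
  assumes \<kappa>: "\<kappa> \<ge> 0" and \<nu>: "\<nu> \<ge> 0" and \<alpha>: "\<alpha> \<ge> 0"
    and M: "M \<ge> 2" and Y: "M \<le> Y" "Y \<le> 2 * M" and q: "0 \<le> q" "q \<le> \<nu> * M\<^sup>2" and v: "\<bar>v\<bar> \<le> M / 2"
  shows "norm (phase \<kappa> \<nu> \<alpha> M q Y v - phase \<kappa> \<nu> \<alpha> M q Y 0) \<le> (2 * (\<alpha> + 1) + \<kappa> * (2 + 31 * \<nu>)) * ((\<bar>v\<bar> + v\<^sup>2) / M)"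
proof -
  define d where "d w = Ln (w + \<i> * of_real Y + \<i> * of_real v) - Ln (w + \<i> * of_real Y)" for w :: complex
  \<comment> \<open>The bound on v keeps the imaginary part above M/2 along the whole
    segment.\<close>
  have d: "norm (d (of_real r)) \<le> 2 * \<bar>v\<bar> / M" if "r > 0" for r
    using norm_Ln_increment_le[of "of_real r + \<i> * of_real Y" "M / 2" v] that M Y v by (simp add: d_def mult.commute)
  define A where "A = of_real M + \<i> * complex_of_real Y"
  define e where "e = A\<^sup>2 / (A + \<i> * of_real v) - A + \<i> * of_real v"
  have e: "norm e \<le> v\<^sup>2 / M" unfolding e_def using M by (intro phase_increment_quadratic) (auto simp: A_def)
  define f where "f = - (of_real q / (2 + \<i> * complex_of_real (Y + v))) + of_real q / (2 + \<i> * complex_of_real Y) + \<i> * complex_of_real (v * (q / Y\<^sup>2))"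
  have f: "norm f \<le> \<nu> * (26 * \<bar>v\<bar> + 4 * v\<^sup>2) / M" unfolding f_def by (rule phase_increment_transversal[OF M Y q v])
  have A0: "A \<noteq> 0" using M by (auto simp: A_def complex_eq_iff)
  have "phase \<kappa> \<nu> \<alpha> M q Y v - phase \<kappa> \<nu> \<alpha> M q Y 0
    = - of_real (\<alpha> + 1) * d (of_real 1) + of_real \<kappa> * (- (1/2) * d (of_real M) - of_real (\<nu> / 2) * d (of_real 2) + e + f)"
  proof -
    have "A\<^sup>2 / A = A" using A0 by (simp add: power2_eq_square)
    then show ?thesis
      unfolding phase_def d_def e_def f_def A_def by (simp add: algebra_simps)
  qed
  also have "norm \<dots> \<le> (\<alpha> + 1) * norm (d (of_real 1)) + \<kappa> * (1/2 * norm (d (of_real M)) + \<nu> / 2 * norm (d (of_real 2)) + norm e + norm f)"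
  proof -
    have "norm (- (1/2) * d (of_real M) - of_real (\<nu> / 2) * d (of_real 2) + e + f)
       \<le> norm (- (1/2) * d (of_real M)) + norm (of_real (\<nu> / 2) * d (of_real 2)) + norm e + norm f"
      by (intro norm_triangle_le add_mono order_refl norm_triangle_le_diff)
    also have "\<dots> = 1/2 * norm (d (of_real M)) + \<nu> / 2 * norm (d (of_real 2)) + norm e + norm f"
      using \<nu> by (simp add: norm_mult)
    finally have "\<kappa> * norm (- (1/2) * d (of_real M) - of_real (\<nu> / 2) * d (of_real 2) + e + f)
       \<le> \<kappa> * (1/2 * norm (d (of_real M)) + \<nu> / 2 * norm (d (of_real 2)) + norm e + norm f)"
      using \<kappa> by (rule mult_left_mono)
    then have "norm (- of_real (\<alpha> + 1) * d (of_real 1)) + norm (of_real \<kappa> * (- (1/2) * d (of_real M) - of_real (\<nu> / 2) * d (of_real 2) + e + f))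
       \<le> (\<alpha> + 1) * norm (d (of_real 1)) + \<kappa> * (1/2 * norm (d (of_real M)) + \<nu> / 2 * norm (d (of_real 2)) + norm e + norm f)"
      using \<kappa> \<alpha> by (simp only: norm_mult norm_minus_cancel norm_of_real)
    then show ?thesis by (rule norm_triangle_le)
  qed
  also have "\<dots> \<le> (\<alpha> + 1) * (2 * \<bar>v\<bar> / M) + \<kappa> * (1/2 * (2 * \<bar>v\<bar> / M) + \<nu> / 2 * (2 * \<bar>v\<bar> / M) + v\<^sup>2 / M + \<nu> * (26 * \<bar>v\<bar> + 4 * v\<^sup>2) / M)"
    using \<kappa> \<alpha> \<nu> M by (intro add_mono mult_left_mono d e f) auto
  also have "\<dots> = ((\<alpha> + 1) * (2 * \<bar>v\<bar>) + \<kappa> * (\<bar>v\<bar> + \<nu> * \<bar>v\<bar> + v\<^sup>2 + \<nu> * (26 * \<bar>v\<bar> + 4 * v\<^sup>2))) / M"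
    using M by (simp add: field_simps)
  also have "\<dots> \<le> ((2 * (\<alpha> + 1) + \<kappa> * (2 + 31 * \<nu>)) * (\<bar>v\<bar> + v\<^sup>2)) / M"
  proof (intro divide_right_mono)
    have "0 \<le> \<alpha> * v\<^sup>2" "0 \<le> \<kappa> * \<bar>v\<bar>" "0 \<le> \<kappa> * v\<^sup>2" "0 \<le> \<kappa> * (\<nu> * \<bar>v\<bar>)" "0 \<le> \<kappa> * (\<nu> * v\<^sup>2)" "0 \<le> v\<^sup>2"
      using \<kappa> \<alpha> \<nu> by auto
    then show "(\<alpha> + 1) * (2 * \<bar>v\<bar>) + \<kappa> * (\<bar>v\<bar> + \<nu> * \<bar>v\<bar> + v\<^sup>2 + \<nu> * (26 * \<bar>v\<bar> + 4 * v\<^sup>2)) \<le> (2 * (\<alpha> + 1) + \<kappa> * (2 + 31 * \<nu>)) * (\<bar>v\<bar> + v\<^sup>2)"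
      by (simp add: algebra_simps)
  qed (use M in auto)
  finally show ?thesis by simp
qed

section \<open>Propagation of plates\<close>

lemma bij_betw_axis_Basis:
  "bij_betw (\<lambda>(i, u). axis i u) (UNIV \<times> (Basis :: 'a::euclidean_space set)) (Basis :: ('a^'k) set)"
  unfolding bij_betw_def inj_on_def Basis_vec_def by (auto simp: axis_eq_axis)

lemma sum_Basis_vec:
  fixes \<phi> :: "('a::euclidean_space)^'k \<Rightarrow> 'c::comm_monoid_add"
  shows "(\<Sum>\<beta>\<in>Basis. \<phi> \<beta>) = (\<Sum>\<iota>\<in>UNIV. \<Sum>b\<in>Basis. \<phi> (axis \<iota> b))"
  using sum.reindex_bij_betw[OF bij_betw_axis_Basis, of \<phi>]
  by (simp add: sum.cartesian_product case_prod_unfold)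

lemma prod_Basis_vec:
  fixes \<phi> :: "('a::euclidean_space)^'k \<Rightarrow> 'c::comm_monoid_mult"
  shows "(\<Prod>\<beta>\<in>Basis. \<phi> \<beta>) = (\<Prod>\<iota>\<in>UNIV. \<Prod>b\<in>Basis. \<phi> (axis \<iota> b))"
  using prod.reindex_bij_betw[OF bij_betw_axis_Basis, of \<phi>]
  by (simp add: prod.cartesian_product case_prod_unfold)

text \<open>
  For basis vectors \<open>e\<close> and \<open>b\<close> the stiffness is \<open>m\<close> if \<open>b = e\<close> and \<open>1\<close> otherwise. The affine formula
  also covers basis vectors of \<open>'a^'k\<close> when \<open>e\<close> is replaced by \<open>(e, \<dots>, e)\<close>.
\<close>

definition stiffness :: "real \<Rightarrow> 'a::euclidean_space \<Rightarrow> 'a \<Rightarrow> real" where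
  "stiffness m e b = 1 + (m - 1) * (b \<bullet> e)"

text \<open>The factor pi^2 turns the stiffness into the coefficient of the Fourier-side Gaussian.
  The frequency (m + 1)/m has two effects: the damping exp (- |\<xi>|^2) moves the centre of that
  Gaussian to e exactly, and the completed square has numerator (M + iY)^2 over a denominator that
  is M + iY at v = 0.\<close>

definition plate :: "real \<Rightarrow> 'a::euclidean_space \<Rightarrow> 'a \<Rightarrow> complex" where
  "plate m e = gauss (\<lambda>b. of_real (pi\<^sup>2 / stiffness m e b)) (\<lambda>b. 2 * of_real pi * \<i> * of_real ((m + 1) / m * (b \<bullet> e)))"

lemma stiffness_Basis:
  assumes "e \<in> Basis"
  shows "stiffness m e e = m" "b \<in> Basis \<Longrightarrow> b \<noteq> e \<Longrightarrow> stiffness m e b = 1"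
  using assms by (auto simp: stiffness_def inner_Basis)

lemma stiffness_pos:
  assumes "e \<in> Basis" "b \<in> Basis" "m > 0"
  shows "stiffness m e b > 0"
  using stiffness_Basis[OF assms(1)] assms by (cases "b = e") auto

lemma stiffness_ge_1:
  assumes "e \<in> Basis" "b \<in> Basis" "m \<ge> 1"
  shows "stiffness m e b \<ge> 1"
  using stiffness_Basis[OF assms(1)] assms by (cases "b = e") auto

lemma schwartz_plate:
  assumes "e \<in> Basis" "m > 0"
  shows "schwartz (plate m e)"
  unfolding plate_def using assms by (intro schwartz_gauss) (auto intro!: divide_pos_pos stiffness_pos)

text \<open>The Fourier character merely shifts the linear coefficient c by an imaginary
  amount.\<close>

lemma fourier_gauss:
  fixes a c :: "'a::euclidean_space \<Rightarrow> complex"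
  assumes "\<And>b. b \<in> Basis \<Longrightarrow> Re (a b) > 0"
  shows "fourier (gauss a c) \<xi> = (\<Prod>b\<in>Basis. of_real (sqrt pi) * a b powr (-1/2) *
      exp ((c b - 2 * of_real pi * \<i> * of_real (\<xi> \<bullet> b))\<^sup>2 / (4 * a b)))"
proof -
  have "gauss a c x * exp (- 2 * of_real pi * \<i> * of_real (x \<bullet> \<xi>)) = gauss a (\<lambda>b. c b - 2 * of_real pi * \<i> * of_real (\<xi> \<bullet> b)) x" for x
  proof -
    have "(\<Sum>b\<in>Basis. c b * of_real (x \<bullet> b) - a b * of_real ((x \<bullet> b)\<^sup>2)) + - 2 * of_real pi * \<i> * of_real (x \<bullet> \<xi>)
      = (\<Sum>b\<in>Basis. c b * of_real (x \<bullet> b) - a b * of_real ((x \<bullet> b)\<^sup>2)) + (\<Sum>b\<in>Basis. - 2 * of_real pi * \<i> * of_real ((x \<bullet> b) * (\<xi> \<bullet> b)))"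
      by (subst euclidean_inner) (simp add: sum_distrib_left sum_negf)
    also have "\<dots> = (\<Sum>b\<in>Basis. (c b - 2 * of_real pi * \<i> * of_real (\<xi> \<bullet> b)) * of_real (x \<bullet> b) - a b * of_real ((x \<bullet> b)\<^sup>2))"
      unfolding sum.distrib[symmetric] by (intro sum.cong refl) (simp add: algebra_simps)
    finally show ?thesis unfolding gauss_def exp_add[symmetric] by (simp only:)
  qed
  then show ?thesis
    unfolding fourier_def using has_bochner_integral_gauss[OF assms, of "\<lambda>b. b"] by (simp add: has_bochner_integral_iff)
qed

lemma of_real_powr_minus_half:
  fixes w :: real
  assumes "w > 0"
  shows "complex_of_real w powr (-1/2) = of_real (1 / sqrt w)"
proof -
  have "complex_of_real w powr (of_real (-1/2)) = of_real (w powr (-1/2))"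
    using assms by (intro powr_of_real) auto
  then show ?thesis using assms by (simp add: powr_minus_divide powr_half_sqrt)
qed

text \<open>Written with its square expanded, not centred: quadratic and linear coefficients can
  then be added directly to those of the propagator. The price is the constant exp (- (m + 1)^2 /
  m).\<close>

lemma fourier_plate:
  fixes e :: "'a::euclidean_space"
  assumes e: "e \<in> Basis" and m: "m > 0"
  shows "fourier (plate m e) \<xi> = of_real ((\<Prod>b\<in>Basis. sqrt (stiffness m e b / pi)) * exp (- (m + 1)\<^sup>2 / m))
     * gauss (\<lambda>b. of_real (stiffness m e b)) (\<lambda>b. of_real (2 * (m + 1) * (b \<bullet> e))) \<xi>"
proof -
  let ?w = "stiffness m e"
  have "fourier (plate m e) \<xi> = (\<Prod>b\<in>Basis. of_real (sqrt pi) * complex_of_real (pi\<^sup>2 / ?w b) powr (-1/2) *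
      exp ((2 * of_real pi * \<i> * of_real ((m + 1) / m * (b \<bullet> e)) - 2 * of_real pi * \<i> * of_real (\<xi> \<bullet> b))\<^sup>2 / (4 * of_real (pi\<^sup>2 / ?w b))))"
    unfolding plate_def by (rule fourier_gauss) (use assms in \<open>auto intro!: divide_pos_pos stiffness_pos\<close>)
  also have "\<dots> = (\<Prod>b\<in>Basis. of_real (sqrt (?w b / pi)) *
       (exp (of_real (- (m + 1)\<^sup>2 / m * (b \<bullet> e))) * exp (of_real (2 * (m + 1) * (b \<bullet> e)) * of_real (\<xi> \<bullet> b) - of_real (?w b) * of_real ((\<xi> \<bullet> b)\<^sup>2))))"
  proof (intro prod.cong refl arg_cong2[where f = times])
    fix b :: 'a assume b: "b \<in> Basis"
    have w: "?w b > 0" by (rule stiffness_pos[OF e b m])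
    have "of_real (sqrt pi) * complex_of_real (pi\<^sup>2 / ?w b) powr (-1/2) = of_real (sqrt pi * (1 / sqrt (pi\<^sup>2 / ?w b)))"
      using w by (subst of_real_powr_minus_half) (auto intro!: divide_pos_pos)
    also have "sqrt pi * (1 / sqrt (pi\<^sup>2 / ?w b)) = sqrt (?w b / pi)"
    proof -
      have "sqrt pi * sqrt pi = pi" by simp
      then show ?thesis by (simp add: real_sqrt_divide field_simps)
    qed
    finally show "of_real (sqrt pi) * complex_of_real (pi\<^sup>2 / ?w b) powr (-1/2) = of_real (sqrt (?w b / pi))" .
    have "(2 * of_real pi * \<i> * of_real ((m + 1) / m * (b \<bullet> e)) - 2 * of_real pi * \<i> * of_real (\<xi> \<bullet> b))\<^sup>2 / (4 * of_real (pi\<^sup>2 / ?w b))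
      = (- (of_real (?w b * ((m + 1) / m * (b \<bullet> e) - \<xi> \<bullet> b)\<^sup>2)) :: complex)"
    proof -
      have "2 * of_real pi * \<i> * of_real ((m + 1) / m * (b \<bullet> e)) - 2 * of_real pi * \<i> * of_real (\<xi> \<bullet> b)
        = 2 * of_real pi * \<i> * complex_of_real ((m + 1) / m * (b \<bullet> e) - \<xi> \<bullet> b)" by (simp add: algebra_simps)
      then show ?thesis using w by (simp add: power_mult_distrib power2_eq_square[of "\<i>"] del: of_real_diff)
    qed
    \<comment> \<open>On basis vectors \<open>b \<bullet> e\<close> is 0 or 1, so its square may be
      written as itself.\<close>
    also have "?w b * ((m + 1) / m * (b \<bullet> e) - \<xi> \<bullet> b)\<^sup>2 = (m + 1)\<^sup>2 / m * (b \<bullet> e) - 2 * (m + 1) * (b \<bullet> e) * (\<xi> \<bullet> b) + ?w b * (\<xi> \<bullet> b)\<^sup>2"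
      using m stiffness_Basis(1)[OF e, of m] stiffness_Basis(2)[OF e b, of m] b e
      by (cases "b = e") (auto simp: inner_Basis field_simps power2_eq_square)
    finally have E: "(2 * of_real pi * \<i> * of_real ((m + 1) / m * (b \<bullet> e)) - 2 * of_real pi * \<i> * of_real (\<xi> \<bullet> b))\<^sup>2 / (4 * of_real (pi\<^sup>2 / ?w b))
      = (- of_real ((m + 1)\<^sup>2 / m * (b \<bullet> e) - 2 * (m + 1) * (b \<bullet> e) * (\<xi> \<bullet> b) + ?w b * (\<xi> \<bullet> b)\<^sup>2) :: complex)" .
    show "exp ((2 * of_real pi * \<i> * of_real ((m + 1) / m * (b \<bullet> e)) - 2 * of_real pi * \<i> * of_real (\<xi> \<bullet> b))\<^sup>2 / (4 * of_real (pi\<^sup>2 / ?w b)))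
       = (exp (of_real (- (m + 1)\<^sup>2 / m * (b \<bullet> e))) * exp (of_real (2 * (m + 1) * (b \<bullet> e)) * of_real (\<xi> \<bullet> b) - of_real (?w b) * of_real ((\<xi> \<bullet> b)\<^sup>2)) :: complex)"
      unfolding E exp_add[symmetric] by (rule arg_cong[of _ _ exp]) simp
  qed
  also have "\<dots> = of_real (\<Prod>b\<in>Basis. sqrt (?w b / pi)) * exp (\<Sum>b\<in>Basis. of_real (- (m + 1)\<^sup>2 / m * (b \<bullet> e)))
     * gauss (\<lambda>b. of_real (?w b)) (\<lambda>b. of_real (2 * (m + 1) * (b \<bullet> e))) \<xi>"
    by (simp only: prod.distrib gauss_def exp_sum[OF finite_Basis, symmetric] of_real_prod mult.assoc)
  also have "(\<Sum>b\<in>Basis. complex_of_real (- (m + 1)\<^sup>2 / m * (b \<bullet> e))) = of_real (- (m + 1)\<^sup>2 / m)"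
  proof -
    have "(\<Sum>b\<in>Basis. b \<bullet> e) = 1" using e by (simp add: inner_Basis sum.delta' if_distrib cong: if_cong)
    then show ?thesis by (simp only: of_real_sum[symmetric] sum_distrib_left[symmetric] mult_1_right)
  qed
  finally show ?thesis by (simp only: exp_of_real of_real_mult)
qed

text \<open>The integrand is a single Gaussian on the k-fold product, with the same coefficients in
  every block, so the integral is a k-th power. Admitting Re z > - 1 includes z = 0, which later
  supplies the integrability of the undamped integrand. Powers are written through \<open>Ln\<close>
  to collect everything in one exponent.\<close>

lemma gaussian_propagation:
  fixes e x :: "'a::euclidean_space" and z :: complex
  assumes e: "e \<in> Basis" and m1: "m \<ge> 1" and z: "Re z > - 1"
  defines "q \<equiv> \<Sum>b\<in>Basis - {e}. pi\<^sup>2 * (x \<bullet> b)\<^sup>2"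
  shows "has_bochner_integral lborel
    (\<lambda>\<xi>::'a^'k. exp (- z * of_real ((norm \<xi>)\<^sup>2)) * ((\<Prod>\<iota>\<in>UNIV. fourier (plate m e) (\<xi> $ \<iota>)) *
        exp (2 * of_real pi * \<i> * of_real (x \<bullet> (\<Sum>\<iota>\<in>UNIV. \<xi> $ \<iota>)))))
    (of_real ((sqrt m * exp (- (m + 1)\<^sup>2 / m)) ^ CARD('k)) *
      exp (of_real (real CARD('k)) * (- (1/2) * Ln (of_real m + z) - of_real (real (DIM('a) - 1) / 2) * Ln (1 + z)
        + (of_real (m + 1) + \<i> * of_real (pi * (x \<bullet> e)))\<^sup>2 / (of_real m + z) - of_real q / (1 + z))))"
proof -
  have m: "m > 0" using m1 by simp
  let ?w = "stiffness m e"
  let ?A = "(\<Prod>b\<in>Basis. sqrt (?w b / pi)) * exp (- (m + 1)\<^sup>2 / m)"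
  define a where "a = (\<lambda>\<beta>::'a^'k. z + of_real (stiffness m (\<chi> \<iota>. e) \<beta>))"
  define c where "c = (\<lambda>\<beta>::'a^'k. of_real (2 * (m + 1) * (\<beta> \<bullet> (\<chi> \<iota>. e))) + 2 * of_real pi * \<i> * of_real (\<beta> \<bullet> (\<chi> \<iota>. x)))"
  have a: "a (axis \<iota> b) = z + of_real (?w b)" for \<iota> b
    by (simp add: a_def stiffness_def inner_axis')
  have c: "c (axis \<iota> b) = of_real (2 * (m + 1) * (b \<bullet> e)) + 2 * of_real pi * \<i> * of_real (x \<bullet> b)" for \<iota> b
    by (simp add: c_def inner_axis' inner_commute)
  have aRe: "Re (a \<beta>) > 0" if \<beta>: "\<beta> \<in> Basis" for \<beta>
  proof -
    obtain \<iota> b where "\<beta> = axis \<iota> b" "b \<in> Basis" using \<beta> unfolding Basis_vec_def by blast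
    then show ?thesis using stiffness_ge_1[OF e _ m1, of b] z by (simp add: a)
  qed
  have integrand: "exp (- z * of_real ((norm \<xi>)\<^sup>2)) * ((\<Prod>\<iota>\<in>UNIV. fourier (plate m e) (\<xi> $ \<iota>)) *
        exp (2 * of_real pi * \<i> * of_real (x \<bullet> (\<Sum>\<iota>\<in>UNIV. \<xi> $ \<iota>)))) = of_real ?A ^ CARD('k) * gauss a c \<xi>" for \<xi> :: "'a^'k"
  proof -
    have 1: "- z * of_real ((norm \<xi>)\<^sup>2) = (\<Sum>\<iota>\<in>UNIV. \<Sum>b\<in>Basis. - z * of_real ((\<xi> $ \<iota> \<bullet> b)\<^sup>2))"
    proof -
      have "(norm \<xi>)\<^sup>2 = (\<Sum>\<iota>\<in>UNIV. \<Sum>b\<in>Basis. (\<xi> $ \<iota> \<bullet> b)\<^sup>2)"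
        unfolding power2_norm_eq_inner by (subst euclidean_inner) (simp add: sum_Basis_vec inner_axis power2_eq_square)
      then show ?thesis by (simp add: sum_distrib_left sum_negf)
    qed
    have 2: "2 * of_real pi * \<i> * of_real (x \<bullet> (\<Sum>\<iota>\<in>UNIV. \<xi> $ \<iota>)) = (\<Sum>\<iota>\<in>UNIV. \<Sum>b\<in>Basis. 2 * of_real pi * \<i> * of_real ((x \<bullet> b) * (\<xi> $ \<iota> \<bullet> b)))"
    proof -
      have "x \<bullet> (\<Sum>\<iota>\<in>UNIV. \<xi> $ \<iota>) = (\<Sum>\<iota>\<in>UNIV. \<Sum>b\<in>Basis. (x \<bullet> b) * (\<xi> $ \<iota> \<bullet> b))"
        unfolding inner_sum_right by (intro sum.cong refl euclidean_inner)
      then show ?thesis by (simp only: of_real_sum sum_distrib_left)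
    qed
    have 3: "(\<Prod>\<iota>\<in>UNIV. fourier (plate m e) (\<xi> $ \<iota>)) = of_real ?A ^ CARD('k) *
       exp (\<Sum>\<iota>\<in>UNIV. \<Sum>b\<in>Basis. of_real (2 * (m + 1) * (b \<bullet> e)) * of_real (\<xi> $ \<iota> \<bullet> b) - of_real (?w b) * of_real ((\<xi> $ \<iota> \<bullet> b)\<^sup>2))"
      unfolding fourier_plate[OF e m] gauss_def by (simp only: prod.distrib prod_constant exp_sum[OF finite, symmetric])
    have 4: "gauss a c \<xi> = exp (\<Sum>\<iota>\<in>UNIV. \<Sum>b\<in>Basis. c (axis \<iota> b) * of_real (\<xi> $ \<iota> \<bullet> b) - a (axis \<iota> b) * of_real ((\<xi> $ \<iota> \<bullet> b)\<^sup>2))"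
      unfolding gauss_def sum_Basis_vec by (simp only: inner_axis)
    have 5: "(\<Sum>\<iota>\<in>UNIV. \<Sum>b\<in>Basis. c (axis \<iota> b) * of_real (\<xi> $ \<iota> \<bullet> b) - a (axis \<iota> b) * of_real ((\<xi> $ \<iota> \<bullet> b)\<^sup>2))
      = (\<Sum>\<iota>\<in>UNIV. \<Sum>b\<in>Basis. - z * of_real ((\<xi> $ \<iota> \<bullet> b)\<^sup>2))
       + ((\<Sum>\<iota>\<in>UNIV. \<Sum>b\<in>Basis. of_real (2 * (m + 1) * (b \<bullet> e)) * of_real (\<xi> $ \<iota> \<bullet> b) - of_real (?w b) * of_real ((\<xi> $ \<iota> \<bullet> b)\<^sup>2))
       + (\<Sum>\<iota>\<in>UNIV. \<Sum>b\<in>Basis. 2 * of_real pi * \<i> * of_real ((x \<bullet> b) * (\<xi> $ \<iota> \<bullet> b))))"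
      unfolding sum.distrib[symmetric] a c by (intro sum.cong refl) (simp add: algebra_simps)
    show ?thesis unfolding 1 2 3 4 5 exp_add by (simp only: mult_ac)
  qed
  let ?G = "\<lambda>b. - (1/2) * Ln (z + of_real (?w b)) + (of_real (2 * (m + 1) * (b \<bullet> e)) + 2 * of_real pi * \<i> * of_real (x \<bullet> b))\<^sup>2 / (4 * (z + of_real (?w b)))"
  have "has_bochner_integral lborel (\<lambda>\<xi>. of_real ?A ^ CARD('k) * gauss a c \<xi>)
     (of_real ?A ^ CARD('k) * (\<Prod>\<beta>\<in>Basis. of_real (sqrt pi) * a \<beta> powr (-1/2) * exp ((c \<beta>)\<^sup>2 / (4 * a \<beta>))))"
    by (intro has_bochner_integral_mult_right has_bochner_integral_gauss aRe)
  also have "(\<Prod>\<beta>\<in>Basis. of_real (sqrt pi) * a \<beta> powr (-1/2) * exp ((c \<beta>)\<^sup>2 / (4 * a \<beta>)))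
     = (\<Prod>b\<in>Basis. of_real (sqrt pi) * exp (?G b)) ^ CARD('k)"
  proof -
    have "of_real (sqrt pi) * (z + of_real (?w b)) powr (-1/2) * exp ((of_real (2 * (m + 1) * (b \<bullet> e)) + 2 * of_real pi * \<i> * of_real (x \<bullet> b))\<^sup>2 / (4 * (z + of_real (?w b))))
      = of_real (sqrt pi) * exp (?G b)" if "b \<in> Basis" for b
    proof -
      have "z + of_real (?w b) \<noteq> 0" using stiffness_ge_1[OF e that m1] z by (auto simp: complex_eq_iff)
      then have "(z + of_real (?w b)) powr (-1/2) = exp (- (1/2) * Ln (z + of_real (?w b)))" by (simp add: powr_def)
      then show ?thesis by (simp only: exp_add mult.assoc)
    qed
    then show ?thesis
      unfolding prod_Basis_vec a c prod_constant
      by (intro arg_cong[where f = "\<lambda>y. y ^ CARD('k)"] prod.cong refl)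
  qed
  also have "of_real ?A ^ CARD('k) * (\<Prod>b\<in>Basis. of_real (sqrt pi) * exp (?G b)) ^ CARD('k)
    = of_real ((sqrt m * exp (- (m + 1)\<^sup>2 / m)) ^ CARD('k)) * exp (of_real (real CARD('k)) * (\<Sum>b\<in>Basis. ?G b))"
  proof -
    \<comment> \<open>The factors sqrt pi of the Gaussian integral cancel those of the Fourier
      transform; only the stiffness m in direction e survives.\<close>
    have r: "(\<Prod>b\<in>Basis. sqrt (?w b / pi)) * (\<Prod>b\<in>(Basis::'a set). sqrt pi) = sqrt m"
    proof -
      have "(\<Prod>b\<in>Basis. sqrt (?w b / pi)) * (\<Prod>b\<in>(Basis::'a set). sqrt pi) = (\<Prod>b\<in>Basis. sqrt (?w b))"
        unfolding prod.distrib[symmetric] by (intro prod.cong refl) (simp add: real_sqrt_divide)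
      also have "\<dots> = sqrt (?w e) * (\<Prod>b\<in>Basis - {e}. sqrt (?w b))" using e by (intro prod.remove) auto
      also have "(\<Prod>b\<in>Basis - {e}. sqrt (?w b)) = 1" using stiffness_Basis(2)[OF e, of _ m] by (intro prod.neutral) auto
      finally show ?thesis using stiffness_Basis(1)[OF e] by simp
    qed
    have "of_real ?A * (\<Prod>b\<in>Basis. of_real (sqrt pi) * exp (?G b)) = of_real ((\<Prod>b\<in>Basis. sqrt (?w b / pi)) * (\<Prod>b\<in>(Basis::'a set). sqrt pi)) * of_real (exp (- (m + 1)\<^sup>2 / m)) * exp (\<Sum>b\<in>Basis. ?G b)"
      by (simp only: prod.distrib exp_sum[OF finite_Basis] of_real_mult of_real_prod mult_ac)
    also have "\<dots> = of_real (sqrt m * exp (- (m + 1)\<^sup>2 / m)) * exp (\<Sum>b\<in>Basis. ?G b)" unfolding r by (simp only: of_real_mult)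
    finally show ?thesis
      unfolding power_mult_distrib[symmetric] by (simp only: power_mult_distrib exp_of_nat_mult of_real_power of_real_mult of_real_of_nat_eq)
  qed
  also have "(\<Sum>b\<in>Basis. ?G b) = - (1/2) * Ln (of_real m + z) - of_real (real (DIM('a) - 1) / 2) * Ln (1 + z)
        + (of_real (m + 1) + \<i> * of_real (pi * (x \<bullet> e)))\<^sup>2 / (of_real m + z) - of_real q / (1 + z)"
  proof -
    have four: "4 * u / (4 * w) = u / w" for u w :: complex by (rule mult_divide_mult_cancel_left) simp
    have "(\<Sum>b\<in>Basis. ?G b) = ?G e + (\<Sum>b\<in>Basis - {e}. ?G b)" using e by (intro sum.remove) auto
    also have "?G e = - (1/2) * Ln (of_real m + z) + (of_real (m + 1) + \<i> * of_real (pi * (x \<bullet> e)))\<^sup>2 / (of_real m + z)"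
    proof -
      have "(of_real (2 * (m + 1) * (e \<bullet> e)) + 2 * of_real pi * \<i> * of_real (x \<bullet> e))\<^sup>2 = 4 * (of_real (m + 1) + \<i> * of_real (pi * (x \<bullet> e)))\<^sup>2"
        using e by (simp add: power2_eq_square algebra_simps)
      then show ?thesis by (simp only: stiffness_Basis(1)[OF e] add.commute[of z] four)
    qed
    also have "(\<Sum>b\<in>Basis - {e}. ?G b) = (\<Sum>b\<in>Basis - {e}. - (1/2) * Ln (1 + z) - of_real (pi\<^sup>2 * (x \<bullet> b)\<^sup>2) / (1 + z))"
    proof (intro sum.cong refl)
      fix b assume "b \<in> Basis - {e}"
      then have b: "b \<in> Basis" "b \<noteq> e" "b \<bullet> e = 0" using e by (auto simp: inner_Basis)
      have "(of_real (2 * (m + 1) * (b \<bullet> e)) + 2 * of_real pi * \<i> * of_real (x \<bullet> b))\<^sup>2 = 4 * (- complex_of_real (pi\<^sup>2 * (x \<bullet> b)\<^sup>2))"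
        using b(3) by (simp add: power_mult_distrib)
      then show "?G b = - (1/2) * Ln (1 + z) - of_real (pi\<^sup>2 * (x \<bullet> b)\<^sup>2) / (1 + z)"
        by (simp only: stiffness_Basis(2)[OF e b(1,2)] add.commute[of z] four of_real_1 minus_divide_left diff_conv_add_uminus)
    qed
    also have "\<dots> = - of_real (real (DIM('a) - 1) / 2) * Ln (1 + z) - of_real q / (1 + z)"
      using e by (simp add: sum_subtractf q_def sum_divide_distrib card_Diff_singleton)
    finally show ?thesis by (simp add: algebra_simps)
  qed
  finally show ?thesis unfolding integrand .
qed

section \<open>Lower bound for the maximal function on the box\<close>

lemma continuous_on_phase:
  assumes "M > 0"
  shows "continuous_on S (phase \<kappa> \<nu> \<alpha> M q Y)"
proof -
  have Ln: "continuous_on S (\<lambda>v. Ln (w + \<i> * of_real (Y + v)))" if "Re w > 0" for w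
    by (rule continuous_on_Ln') (use that in \<open>auto intro!: continuous_intros simp: complex_nonpos_Reals_iff\<close>)
  have div: "continuous_on S (\<lambda>v. u / (w + \<i> * of_real (Y + v)))" if "Re w > 0" for u w
    by (intro continuous_on_divide continuous_on_const continuous_on_add continuous_on_mult continuous_on_of_real continuous_on_id)
      (use that in \<open>auto simp: complex_eq_iff\<close>)
  have lin: "continuous_on S (\<lambda>v. \<i> * complex_of_real (v * (\<kappa> * (1 + q / Y\<^sup>2))))"
    by (intro continuous_intros)
  show ?thesis unfolding phase_def[abs_def]
    by (intro continuous_on_add continuous_on_diff continuous_on_mult[OF continuous_on_const] Ln div lin) (use assms in auto)
qed

text \<open>No cancellation: an exponent within 1/4 of w keeps Re (exp (L - w)) above 1/2, and the
  interval has length 2a.\<close>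

lemma norm_integral_exp_ge:
  fixes L :: "real \<Rightarrow> complex"
  assumes a: "a \<ge> 0" and cont: "continuous_on {-a..a} L"
    and L: "\<And>v. \<bar>v\<bar> \<le> a \<Longrightarrow> norm (L v - w) \<le> 1 / 4"
  shows "a * exp (Re w) \<le> norm (LINT v|lborel. indicator {-a..a} v * exp (L v))"
proof -
  let ?g = "\<lambda>v. indicator {-a..a} v * exp (L v - w)"
  have "continuous_on {-a..a} (\<lambda>v. exp (L v - w))" by (intro continuous_intros cont)
  then have "integrable lborel (\<lambda>v. indicator {-a..a} v *\<^sub>R exp (L v - w))"
    using borel_integrable_atLeastAtMost' unfolding set_integrable_def by blast
  then have int: "integrable lborel ?g" by (simp add: scaleR_conv_of_real of_real_indicator)
  have half: "1/2 \<le> Re (exp u)" if u: "norm u \<le> 1/4" for u :: complex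
  proof -
    have "norm (exp u - 1) \<le> norm u * exp (norm u)" by (rule norm_exp_minus_one_le)
    also have "\<dots> \<le> 1/4 * exp (1/4)" using u by (intro mult_mono) auto
    also have "exp (1/4::real) \<le> 2" using exp_bound_half[of "1/4::real"] by simp
    finally have "norm (exp u - 1) \<le> 1/2" by simp
    moreover have "\<bar>Re (exp u - 1)\<bar> \<le> norm (exp u - 1)" by (rule abs_Re_le_cmod)
    ultimately show ?thesis by simp
  qed
  have "a = (LINT v|lborel. indicator {-a..a} v * (1/2))" using a by simp
  also have "\<dots> \<le> (LINT v|lborel. Re (?g v))"
  proof (rule integral_mono)
    show "integrable lborel (\<lambda>v. indicator {-a..a} v * (1/2::real))"
      by (intro integrable_mult_left integrable_real_indicator) (auto simp: emeasure_lborel_Icc_eq)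
    show "integrable lborel (\<lambda>v. Re (?g v))" using int by (rule integrable_Re)
    fix v show "indicator {-a..a} v * (1/2) \<le> Re (?g v)"
      using half[OF L, of v] by (auto simp: indicator_def)
  qed
  also have "\<dots> = Re (LINT v|lborel. ?g v)" by (rule integral_Re[OF int])
  also have "\<dots> \<le> norm (LINT v|lborel. ?g v)" by (rule complex_Re_le_cmod)
  finally have "a * exp (Re w) \<le> norm (LINT v|lborel. ?g v) * exp (Re w)" by (intro mult_right_mono) auto
  also have "\<dots> = norm ((LINT v|lborel. ?g v) * exp w)" by (simp add: norm_mult)
  also have "(LINT v|lborel. ?g v) * exp w = (LINT v|lborel. ?g v * exp w)" by simp
  also have "(\<lambda>v. ?g v * exp w) = (\<lambda>v. indicator {-a..a} v * exp (L v))"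
    by (simp add: mult.assoc exp_add[symmetric])
  finally show ?thesis .
qed

text \<open>The arguments of the three logarithms have modulus at most M + Y \<le> 3M, which gives
  the power of M. The completed square at v = 0 is M + iY with real part M, and the transversal term
  loses at most 2\<nu>.\<close>

lemma phase_zero_ge:
  fixes \<kappa> \<nu> \<alpha> :: real
  assumes \<kappa>: "\<kappa> \<ge> 0" and \<nu>: "\<nu> \<ge> 0" and \<alpha>: "\<alpha> \<ge> 0"
    and M: "M \<ge> 2" and Y: "M \<le> Y" "Y \<le> 2 * M" and q: "0 \<le> q" "q \<le> \<nu> * M\<^sup>2"
  shows "(3 * M) powr (- (\<alpha> + 1 + \<kappa> / 2 + \<kappa> * \<nu> / 2)) * exp (\<kappa> * (M - 2 * \<nu>)) \<le> exp (Re (phase \<kappa> \<nu> \<alpha> M q Y 0))"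
proof -
  have ln: "Re (Ln (of_real r + \<i> * of_real Y)) \<le> ln (3 * M)" if r: "0 < r" "r \<le> M" for r
  proof -
    have nz: "of_real r + \<i> * of_real Y \<noteq> 0" using r by (auto simp: complex_eq_iff)
    have "norm (of_real r + \<i> * of_real Y) \<le> r + Y"
      using r M Y by (intro order_trans[OF norm_triangle_ineq]) (simp add: norm_mult)
    also have "\<dots> \<le> 3 * M" using r Y by simp
    finally show ?thesis using nz M by (simp add: Re_Ln)
  qed
  have A: "(of_real M + \<i> * of_real Y)\<^sup>2 / (of_real M + \<i> * of_real Y) = of_real M + \<i> * complex_of_real Y"
    using M by (simp add: power2_eq_square)
  have B: "Re (of_real q / (2 + \<i> * of_real Y)) \<le> 2 * \<nu>"
  proof -
    have "Re (of_real q / (2 + \<i> * of_real Y)) = q * 2 / (4 + Y\<^sup>2)"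
      by (simp add: Re_divide power2_eq_square)
    also have "\<dots> \<le> (\<nu> * M\<^sup>2) * 2 / M\<^sup>2"
    proof (rule frac_le)
      have "M\<^sup>2 \<le> Y\<^sup>2" using M Y by (intro power_mono) auto
      then show "M\<^sup>2 \<le> 4 + Y\<^sup>2" by simp
    qed (use M q \<nu> in auto)
    also have "\<dots> = 2 * \<nu>" using M by simp
    finally show ?thesis .
  qed
  define u where "u = of_real q / (2 + \<i> * complex_of_real Y)"
  have "- (\<alpha> + 1 + \<kappa> / 2 + \<kappa> * \<nu> / 2) * ln (3 * M) + \<kappa> * (M - 2 * \<nu>)
    = - ((\<alpha> + 1) * ln (3 * M)) + \<kappa> * (- (1/2 * ln (3 * M)) - \<nu> / 2 * ln (3 * M) + M - 2 * \<nu>)"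
    by (simp add: field_simps)
  also have "\<dots> \<le> - ((\<alpha> + 1) * Re (Ln (of_real 1 + \<i> * of_real Y)))
     + \<kappa> * (- (1/2 * Re (Ln (of_real M + \<i> * of_real Y))) - \<nu> / 2 * Re (Ln (of_real 2 + \<i> * of_real Y)) + M - Re u)"
    unfolding u_def
    using \<kappa> \<alpha> \<nu> M by (intro add_mono mult_left_mono diff_mono ln B order_refl le_imp_neg_le) auto
  also have "\<dots> = Re (phase \<kappa> \<nu> \<alpha> M q Y 0)"
    unfolding phase_def add_0_right A u_def[symmetric] by (simp add: algebra_simps)
  finally have "exp (- (\<alpha> + 1 + \<kappa> / 2 + \<kappa> * \<nu> / 2) * ln (3 * M) + \<kappa> * (M - 2 * \<nu>)) \<le> exp (Re (phase \<kappa> \<nu> \<alpha> M q Y 0))"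
    by simp
  then show ?thesis using M by (simp add: powr_def exp_add)
qed

text \<open>Two evaluations of one double average: from above through a bound B on all means at x
  and the weight bound C, from below through the propagated Gaussian and its nearly constant
  phase.\<close>

lemma plate_mean_lower:
  fixes x e :: "real^'n" and \<alpha> m a B C :: real
  assumes e: "e \<in> Basis" and m: "m \<ge> 1" and \<alpha>: "\<alpha> \<ge> 0"
    and B: "\<And>R. R > 0 \<Longrightarrow> norm (br_mean \<alpha> R (\<lambda>_::'k::finite. plate m e) x) \<le> B"
    and Y: "m + 1 \<le> pi * (x \<bullet> e)" "pi * (x \<bullet> e) \<le> 2 * (m + 1)"
    and x: "\<And>b. b \<in> Basis \<Longrightarrow> b \<noteq> e \<Longrightarrow> \<bar>pi * (x \<bullet> b)\<bar> \<le> m + 1"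
    and a: "a > 0" "a \<le> (m + 1) / 2"
      "(2 * (\<alpha> + 1) + real CARD('k) * (2 + 31 * (real CARD('n) - 1))) * ((a + a\<^sup>2) / (m + 1)) \<le> 1/4"
    and C: "\<And>t0. (LINT t|lborel. indicator {0<..} t * t powr \<alpha> * exp (- t) * norm (dirichlet a (t - t0))) \<le> C"
  shows "Gamma (\<alpha> + 1) * (sqrt m * exp (- (m + 1)\<^sup>2 / m)) ^ CARD('k) *
      (a * ((3 * (m + 1)) powr (- (\<alpha> + 1 + real CARD('k) / 2 + real CARD('k) * (real CARD('n) - 1) / 2)) *
        exp (real CARD('k) * ((m + 1) - 2 * (real CARD('n) - 1))))) \<le> B * C"
proof -
  define \<kappa> where "\<kappa> = real CARD('k)"
  define \<nu> where "\<nu> = real CARD('n) - 1"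
  have \<nu>': "real (DIM(real^'n) - 1) = \<nu>" by (simp add: \<nu>_def of_nat_diff)
  have \<kappa>0: "\<kappa> \<ge> 0" and \<nu>0: "\<nu> \<ge> 0" by (auto simp: \<kappa>_def \<nu>_def)
  define M where "M = m + 1"
  define Y where "Y = pi * (x \<bullet> e)"
  define q where "q = (\<Sum>b\<in>Basis - {e}. pi\<^sup>2 * (x \<bullet> b)\<^sup>2)"
  \<comment> \<open>This is |\<xi>|^2 at the stationary frequency, whose k blocks all equal x / (x
    \<bullet> e), the velocity that carries a packet from the origin to x. The kernel is thus
    centred at the square of the radius that matters for x.\<close>
  define t0 where "t0 = \<kappa> * (1 + q / Y\<^sup>2)"
  have M: "M \<ge> 2" using m by (simp add: M_def)
  have YM: "M \<le> Y" "Y \<le> 2 * M" using Y by (auto simp: Y_def M_def)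
  have q: "0 \<le> q" "q \<le> \<nu> * M\<^sup>2"
  proof -
    show "0 \<le> q" unfolding q_def by (intro sum_nonneg) auto
    have "q \<le> (\<Sum>b\<in>Basis - {e}. M\<^sup>2)" unfolding q_def
    proof (intro sum_mono)
      fix b assume "b \<in> Basis - {e}"
      then have "\<bar>pi * (x \<bullet> b)\<bar> \<le> \<bar>M\<bar>" using x[of b] m by (simp add: M_def)
      then show "pi\<^sup>2 * (x \<bullet> b)\<^sup>2 \<le> M\<^sup>2" unfolding abs_le_square_iff power_mult_distrib .
    qed
    also have "\<dots> = \<nu> * M\<^sup>2" using e by (simp add: card_Diff_singleton \<nu>_def of_nat_diff)
    finally show "q \<le> \<nu> * M\<^sup>2" .
  qed
  define F where "F = (\<lambda>\<xi>::real^'n^'k. (\<Prod>\<iota>\<in>UNIV. fourier (plate m e) (\<xi> $ \<iota>)) *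
        exp (2 * of_real pi * \<i> * of_real (x \<bullet> (\<Sum>\<iota>\<in>UNIV. \<xi> $ \<iota>))))"
  have propagation: "has_bochner_integral lborel (\<lambda>\<xi>. exp (- z * of_real ((norm \<xi>)\<^sup>2)) * F \<xi>)
      (of_real ((sqrt m * exp (- M\<^sup>2 / m)) ^ CARD('k)) *
      exp (of_real \<kappa> * (- (1/2) * Ln (of_real m + z) - of_real (\<nu> / 2) * Ln (1 + z)
        + (of_real M + \<i> * of_real Y)\<^sup>2 / (of_real m + z) - of_real q / (1 + z))))" if "Re z > - 1" for z
    unfolding F_def M_def Y_def q_def \<kappa>_def
    by (rule gaussian_propagation[OF e m that, where x = x, unfolded \<nu>'])
  \<comment> \<open>The case z = 0 of the propagation formula.\<close>
  have F: "integrable lborel F"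
    using propagation[of 0] by (simp add: has_bochner_integral_iff)
  then have [measurable]: "F \<in> borel_measurable borel" by (auto dest: borel_measurable_integrable)
  define b where "b = (\<lambda>t. LINT \<xi>|lborel. of_real (max 0 (1 - (norm \<xi>)\<^sup>2 / t) powr \<alpha>) * F \<xi>)"
  have [measurable]: "b \<in> borel_measurable borel" unfolding b_def by measurable
  have bB: "norm (b t) \<le> B" if t: "t > 0" for t
  proof -
    \<comment> \<open>Passage from the radius R to t = R^2.\<close>
    have "br_symbol \<alpha> (inverse (sqrt t) *\<^sub>R \<xi>) = max 0 (1 - (norm \<xi>)\<^sup>2 / t) powr \<alpha>" for \<xi> :: "real^'n^'k"
      using t by (simp add: br_symbol_def power_mult_distrib power_divide field_simps)
    then have "br_mean \<alpha> (sqrt t) (\<lambda>_::'k. plate m e) x = b t"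
      unfolding br_mean_def b_def F_def by (simp add: mult.assoc)
    then show ?thesis using B[of "sqrt t"] t by simp
  qed
  let ?K = "Gamma (\<alpha> + 1) * (sqrt m * exp (- M\<^sup>2 / m)) ^ CARD('k)"
  have "norm (LINT v|lborel. indicator {-a..a} v * exp (\<i> * of_real (v * t0)) *
            (LINT t|lborel. of_real (indicator {0<..} t * t powr \<alpha>) * exp (- (1 + \<i> * of_real (Y + v)) * of_real t) * b t))
    \<le> B * (LINT t|lborel. indicator {0<..} t * t powr \<alpha> * exp (- t) * norm (dirichlet a (t - t0)))"
    by (rule norm_averaged_integral_le[OF _ bB \<alpha>]) auto
  also have "\<dots> \<le> B * C" using order_trans[OF norm_ge_zero bB[of 1]] by (intro mult_left_mono C) auto
  also have "(\<lambda>v. indicator {-a..a} v * exp (\<i> * of_real (v * t0)) *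
            (LINT t|lborel. of_real (indicator {0<..} t * t powr \<alpha>) * exp (- (1 + \<i> * of_real (Y + v)) * of_real t) * b t))
     = (\<lambda>v. of_real ?K * (indicator {-a..a} v * exp (phase \<kappa> \<nu> \<alpha> M q Y v)))"
  proof
    fix v :: real
    define z where "z = 1 + \<i> * complex_of_real (Y + v)"
    have z: "Re z > 0" "z \<noteq> 0" by (auto simp: z_def complex_eq_iff)
    have i: "(LINT t|lborel. of_real (indicator {0<..} t * t powr \<alpha>) * exp (- z * of_real t) * b t)
      = of_real (Gamma (\<alpha> + 1)) * z powr (- of_real (\<alpha> + 1)) * (LINT \<xi>|lborel. exp (- z * of_real ((norm \<xi>)\<^sup>2)) * F \<xi>)"
      unfolding b_def by (rule integral_riesz_means[OF F z(1) \<alpha>])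
    have ii: "(LINT \<xi>|lborel. exp (- z * of_real ((norm \<xi>)\<^sup>2)) * F \<xi>) = of_real ((sqrt m * exp (- M\<^sup>2 / m)) ^ CARD('k)) *
      exp (of_real \<kappa> * (- (1/2) * Ln (of_real m + z) - of_real (\<nu> / 2) * Ln (1 + z)
        + (of_real M + \<i> * of_real Y)\<^sup>2 / (of_real m + z) - of_real q / (1 + z)))"
      using propagation[of z] z by (simp add: has_bochner_integral_iff)
    have iii: "of_real m + z = of_real M + \<i> * of_real (Y + v)" "1 + z = 2 + \<i> * of_real (Y + v)"
      by (simp_all add: z_def M_def)
    have iv: "z powr (- of_real (\<alpha> + 1)) = exp (- of_real (\<alpha> + 1) * Ln (1 + \<i> * of_real (Y + v)))"
      using z(2) by (simp add: powr_def z_def)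
    have v: "exp (\<i> * of_real (v * t0)) * (exp (- of_real (\<alpha> + 1) * Ln (1 + \<i> * of_real (Y + v))) *
        exp (of_real \<kappa> * (- (1/2) * Ln (of_real M + \<i> * of_real (Y + v)) - of_real (\<nu> / 2) * Ln (2 + \<i> * of_real (Y + v))
        + (of_real M + \<i> * of_real Y)\<^sup>2 / (of_real M + \<i> * of_real (Y + v)) - of_real q / (2 + \<i> * of_real (Y + v)))))
      = exp (phase \<kappa> \<nu> \<alpha> M q Y v)"
      unfolding phase_def exp_add t0_def by (simp only: mult_ac)
    show "indicator {-a..a} v * exp (\<i> * of_real (v * t0)) *
            (LINT t|lborel. of_real (indicator {0<..} t * t powr \<alpha>) * exp (- (1 + \<i> * of_real (Y + v)) * of_real t) * b t)
      = of_real ?K * (indicator {-a..a} v * exp (phase \<kappa> \<nu> \<alpha> M q Y v))"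
      unfolding z_def[symmetric] unfolding i ii
      unfolding iii iv v[symmetric] of_real_mult by (simp only: mult_ac)
  qed
  also have "norm (LINT v|lborel. of_real ?K * (indicator {-a..a} v * exp (phase \<kappa> \<nu> \<alpha> M q Y v)))
    = \<bar>?K\<bar> * norm (LINT v|lborel. indicator {-a..a} v * exp (phase \<kappa> \<nu> \<alpha> M q Y v))"
    by (simp only: integral_mult_right_zero norm_mult norm_of_real)
  finally have 1: "\<bar>?K\<bar> * norm (LINT v|lborel. indicator {-a..a} v * exp (phase \<kappa> \<nu> \<alpha> M q Y v)) \<le> B * C" .
  have K0: "?K \<ge> 0" using m \<alpha> by (intro mult_nonneg_nonneg less_imp_le[OF Gamma_real_pos] zero_le_power) auto
  have "a * exp (Re (phase \<kappa> \<nu> \<alpha> M q Y 0)) \<le> norm (LINT v|lborel. indicator {-a..a} v * exp (phase \<kappa> \<nu> \<alpha> M q Y v))"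
  proof (rule norm_integral_exp_ge)
    show "continuous_on {-a..a} (phase \<kappa> \<nu> \<alpha> M q Y)" using M by (intro continuous_on_phase) auto
    fix v :: real assume v: "\<bar>v\<bar> \<le> a"
    have "norm (phase \<kappa> \<nu> \<alpha> M q Y v - phase \<kappa> \<nu> \<alpha> M q Y 0) \<le> (2 * (\<alpha> + 1) + \<kappa> * (2 + 31 * \<nu>)) * ((\<bar>v\<bar> + v\<^sup>2) / M)"
      using v a M by (intro phase_increment \<kappa>0 \<nu>0 \<alpha> M YM q) (auto simp: M_def)
    also have "\<dots> \<le> (2 * (\<alpha> + 1) + \<kappa> * (2 + 31 * \<nu>)) * ((a + a\<^sup>2) / M)"
    proof -
      have "v\<^sup>2 \<le> a\<^sup>2" using v a by (simp add: abs_le_square_iff[symmetric])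
      then show ?thesis using v M \<kappa>0 \<nu>0 \<alpha> by (intro mult_left_mono divide_right_mono add_mono) auto
    qed
    also have "\<dots> \<le> 1/4" using a(3) by (simp add: \<kappa>_def \<nu>_def M_def)
    finally show "norm (phase \<kappa> \<nu> \<alpha> M q Y v - phase \<kappa> \<nu> \<alpha> M q Y 0) \<le> 1 / 4" .
  qed (use a in auto)
  moreover have "a * ((3 * M) powr (- (\<alpha> + 1 + \<kappa> / 2 + \<kappa> * \<nu> / 2)) * exp (\<kappa> * (M - 2 * \<nu>))) \<le> a * exp (Re (phase \<kappa> \<nu> \<alpha> M q Y 0))"
    using a by (intro mult_left_mono phase_zero_ge \<kappa>0 \<nu>0 \<alpha> M YM q) auto
  ultimately have le: "a * ((3 * M) powr (- (\<alpha> + 1 + \<kappa> / 2 + \<kappa> * \<nu> / 2)) * exp (\<kappa> * (M - 2 * \<nu>)))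
    \<le> norm (LINT v|lborel. indicator {-a..a} v * exp (phase \<kappa> \<nu> \<alpha> M q Y v))"
    by (rule order_trans[rotated])
  have "?K * (a * ((3 * M) powr (- (\<alpha> + 1 + \<kappa> / 2 + \<kappa> * \<nu> / 2)) * exp (\<kappa> * (M - 2 * \<nu>))))
    \<le> \<bar>?K\<bar> * norm (LINT v|lborel. indicator {-a..a} v * exp (phase \<kappa> \<nu> \<alpha> M q Y v))"
    by (intro mult_mono le abs_ge_self) (use a in auto)
  also note 1
  finally show ?thesis by (simp only: M_def \<kappa>_def \<nu>_def)
qed

lemma br_max_plate_ge:
  fixes \<alpha> :: real
  assumes \<alpha>: "\<alpha> \<ge> 0"
  obtains c where "c > 0"
    "\<And>m e (x::real^'n). m \<ge> 1 \<Longrightarrow> e \<in> Basis \<Longrightarrow> m + 1 \<le> pi * (x \<bullet> e) \<Longrightarrow> pi * (x \<bullet> e) \<le> 2 * (m + 1)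
       \<Longrightarrow> (\<And>b. b \<in> Basis \<Longrightarrow> b \<noteq> e \<Longrightarrow> \<bar>pi * (x \<bullet> b)\<bar> \<le> m + 1)
       \<Longrightarrow> ennreal (c * (m + 1) powr (- (\<alpha> + 1/2 + real CARD('k) * (real CARD('n) - 1) / 2)) / (1 + ln (1 + sqrt (m + 1))))
         \<le> br_max \<alpha> (\<lambda>_::'k::finite. plate m e) x"
proof -
  obtain C where C: "C > 0"
    "\<And>a t0. a > 0 \<Longrightarrow> (LINT t|lborel. indicator {0<..} t * t powr \<alpha> * exp (- t) * norm (dirichlet a (t - t0))) \<le> C * (1 + ln (1 + a))"
    using weighted_dirichlet_bound[OF \<alpha>] by blast
  define \<kappa> where "\<kappa> = real CARD('k)"
  define \<nu> where "\<nu> = real CARD('n) - 1"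
  have \<kappa>0: "\<kappa> \<ge> 0" and \<nu>0: "\<nu> \<ge> 0" by (auto simp: \<kappa>_def \<nu>_def)
  define K where "K = 2 * (\<alpha> + 1) + \<kappa> * (2 + 31 * \<nu>)"
  have K: "K \<ge> 2" using \<alpha> \<kappa>0 \<nu>0 by (simp add: K_def)
  \<comment> \<open>Since a + a^2 is at most 2 c0 M for a = c0 sqrt M, the value 1/(8K) makes the
    phase variation at most 1/4.\<close>
  define c0 where "c0 = 1 / (8 * K)"
  have c0: "c0 > 0" "c0 \<le> 1/16" using K by (auto simp: c0_def field_simps)
  define \<sigma> where "\<sigma> = \<alpha> + 1 + \<kappa> / 2 + \<kappa> * \<nu> / 2"
  define G where "G = Gamma (\<alpha> + 1)"
  have G: "G > 0" using \<alpha> by (auto simp: G_def intro!: Gamma_real_pos)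
  \<comment> \<open>The power of 2 comes from m \<ge> M/2, the exponential from M^2/m \<le> M + 2
    and the transversal loss, and the last factors from the length of the average and from (3M) in
    \<open>phase_zero_ge\<close>.\<close>
  define c where "c = G * (2 powr (- \<kappa> / 2) * exp (- 2 * \<kappa> - 2 * \<kappa> * \<nu>)) * (c0 * 3 powr (- \<sigma>)) / C"
  show thesis
  proof (rule that)
    show "c > 0" using G c0 C by (simp add: c_def)
    fix m :: real and e x :: "real^'n"
    assume m: "m \<ge> 1" and e: "e \<in> Basis" and Y: "m + 1 \<le> pi * (x \<bullet> e)" "pi * (x \<bullet> e) \<le> 2 * (m + 1)"
      and x: "\<And>b. b \<in> Basis \<Longrightarrow> b \<noteq> e \<Longrightarrow> \<bar>pi * (x \<bullet> b)\<bar> \<le> m + 1"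
    define M where "M = m + 1"
    have M: "M \<ge> 2" using m by (simp add: M_def)
    have sM: "1 \<le> sqrt M" "sqrt M \<le> M" "(sqrt M)\<^sup>2 = M"
      using M by (auto simp: real_le_lsqrt power2_eq_square intro: mult_left_le_one_le)
    define a where "a = c0 * sqrt M"
    have a0: "a > 0" using c0 sM by (simp add: a_def)
    have aM: "a \<le> sqrt M / 16" using c0 sM by (simp add: a_def mult_right_mono)
    have aK: "K * ((a + a\<^sup>2) / M) \<le> 1/4"
    proof -
      have "a + a\<^sup>2 \<le> c0 * M + c0 * M"
      proof (intro add_mono)
        show "a \<le> c0 * M" using c0 sM by (simp add: a_def)
        have "a\<^sup>2 = c0 * (c0 * M)" using sM(3) by (simp add: a_def power_mult_distrib) (simp add: power2_eq_square)
        also have "\<dots> \<le> 1 * (c0 * M)" using c0 M by (intro mult_right_mono) auto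
        finally show "a\<^sup>2 \<le> c0 * M" by simp
      qed
      then have "(a + a\<^sup>2) / M \<le> (c0 * M + c0 * M) / M" using M by (intro divide_right_mono) auto
      also have "\<dots> = 2 * c0" using M by simp
      finally have "K * ((a + a\<^sup>2) / M) \<le> K * (2 * c0)" using K by (intro mult_left_mono) auto
      also have "\<dots> = 1/4" using K by (simp add: c0_def)
      finally show ?thesis .
    qed
    have lnM: "0 \<le> ln (1 + a)" "ln (1 + a) \<le> ln (1 + sqrt M)" using a0 aM sM by (auto intro: ln_mono)
    let ?s = "\<alpha> + 1/2 + \<kappa> * \<nu> / 2"
    \<comment> \<open>Stated for a real bound B on all means at x; an infinite maximal function is
      treated separately below.\<close>
    have key: "c * M powr (- ?s) / (1 + ln (1 + sqrt M)) \<le> B"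
      if B: "\<And>R. R > 0 \<Longrightarrow> norm (br_mean \<alpha> R (\<lambda>_::'k. plate m e) x) \<le> B" for B
    proof -
      have B0: "B \<ge> 0" by (rule order_trans[OF norm_ge_zero B[of 1]]) simp
      have "G * (sqrt m * exp (- M\<^sup>2 / m)) ^ CARD('k) * (a * ((3 * M) powr (- \<sigma>) * exp (\<kappa> * (M - 2 * \<nu>)))) \<le> B * (C * (1 + ln (1 + a)))"
        unfolding M_def \<sigma>_def \<kappa>_def \<nu>_def G_def
      proof (rule plate_mean_lower[OF e m \<alpha> B Y x])
        show "a \<le> (m + 1) / 2" using aM sM by (simp add: M_def)
        show "(2 * (\<alpha> + 1) + real CARD('k) * (2 + 31 * (real CARD('n) - 1))) * ((a + a\<^sup>2) / (m + 1)) \<le> 1/4"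
          using aK by (simp only: K_def \<kappa>_def \<nu>_def M_def)
      qed (use a0 C in auto)
      also have "\<dots> \<le> B * (C * (1 + ln (1 + sqrt M)))"
        using B0 C lnM by (intro mult_left_mono) auto
      finally have 1: "G * (sqrt m * exp (- M\<^sup>2 / m)) ^ CARD('k) * (a * ((3 * M) powr (- \<sigma>) * exp (\<kappa> * (M - 2 * \<nu>)))) \<le> B * (C * (1 + ln (1 + sqrt M)))" .
      have 2: "M powr (\<kappa> / 2) * (2 powr (- \<kappa> / 2) * exp (- 2 * \<kappa> - 2 * \<kappa> * \<nu>)) \<le> (sqrt m * exp (- M\<^sup>2 / m)) ^ CARD('k) * exp (\<kappa> * (M - 2 * \<nu>))"
      proof -
        have "(sqrt m * exp (- M\<^sup>2 / m)) ^ CARD('k) * exp (\<kappa> * (M - 2 * \<nu>)) = m powr (\<kappa> / 2) * exp (\<kappa> * (- M\<^sup>2 / m) + \<kappa> * (M - 2 * \<nu>))"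
          using m by (simp only: power_mult_distrib powr_half_sqrt[symmetric] exp_of_nat_mult[symmetric] \<kappa>_def exp_add)
            (simp add: powr_power)
        moreover have "(M / 2) powr (\<kappa> / 2) \<le> m powr (\<kappa> / 2)" using M m \<kappa>0 by (intro powr_mono2) (auto simp: M_def)
        moreover have "(M / 2) powr (\<kappa> / 2) = M powr (\<kappa> / 2) * 2 powr (- \<kappa> / 2)"
          using M by (simp add: powr_divide powr_minus_divide)
        \<comment> \<open>The exponentially small constant of the Fourier transforms and the growth
          exp (\<kappa> M) of the propagated Gaussian cancel up to a bounded factor.\<close>
        moreover have "exp (- 2 * \<kappa> - 2 * \<kappa> * \<nu>) \<le> exp (\<kappa> * (- M\<^sup>2 / m) + \<kappa> * (M - 2 * \<nu>))"
        proof -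
          have "M\<^sup>2 / m = M + 1 + 1 / m" using m by (simp add: M_def field_simps power2_eq_square)
          also have "\<dots> \<le> M + 2" using m by simp
          finally have "\<kappa> * (M\<^sup>2 / m) \<le> \<kappa> * (M + 2)" using \<kappa>0 by (rule mult_left_mono)
          then show ?thesis by (simp add: algebra_simps)
        qed
        ultimately show ?thesis
          by (simp only: mult.assoc[symmetric]) (intro mult_mono, auto)
      qed
      have 3: "c * C * M powr (- ?s) = G * (M powr (\<kappa> / 2) * (2 powr (- \<kappa> / 2) * exp (- 2 * \<kappa> - 2 * \<kappa> * \<nu>))) * (a * (3 * M) powr (- \<sigma>))"
      proof -
        \<comment> \<open>The three factors come from the normalization sqrt m of each plate, the
          length a of the average and \<open>phase_zero_ge\<close>.\<close>
        have "M powr (- ?s) = M powr (\<kappa> / 2) * sqrt M * M powr (- \<sigma>)"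
        proof -
          have "sqrt M = M powr (1/2)" using M by (simp add: powr_half_sqrt)
          then show ?thesis
            unfolding \<sigma>_def by (simp only: powr_add[symmetric]) (rule arg_cong[of _ _ "\<lambda>y. M powr y"], simp add: field_simps)
        qed
        moreover have "(3 * M) powr (- \<sigma>) = 3 powr (- \<sigma>) * M powr (- \<sigma>)" using M by (simp add: powr_mult)
        ultimately show ?thesis using C by (simp add: c_def a_def mult_ac)
      qed
      have "c * C * M powr (- ?s) \<le> G * ((sqrt m * exp (- M\<^sup>2 / m)) ^ CARD('k) * exp (\<kappa> * (M - 2 * \<nu>))) * (a * (3 * M) powr (- \<sigma>))"
        unfolding 3 using G a0 by (intro mult_right_mono mult_left_mono 2) auto
      also have "\<dots> \<le> B * (C * (1 + ln (1 + sqrt M)))" using 1 by (simp only: mult_ac)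
      finally have "C * (c * M powr (- ?s)) \<le> C * (B * (1 + ln (1 + sqrt M)))" by (simp only: mult_ac)
      then have "c * M powr (- ?s) \<le> B * (1 + ln (1 + sqrt M))" using C by simp
      then show ?thesis using lnM by (simp add: divide_le_eq)
    qed
    show "ennreal (c * (m + 1) powr (- (\<alpha> + 1/2 + real CARD('k) * (real CARD('n) - 1) / 2)) / (1 + ln (1 + sqrt (m + 1))))
         \<le> br_max \<alpha> (\<lambda>_::'k. plate m e) x"
    proof (cases "br_max \<alpha> (\<lambda>_::'k. plate m e) x = \<infinity>")
      case False
      have "norm (br_mean \<alpha> R (\<lambda>_::'k. plate m e) x) \<le> enn2real (br_max \<alpha> (\<lambda>_::'k. plate m e) x)" if "R > 0" for R
      proof -
        have "ennreal (norm (br_mean \<alpha> R (\<lambda>_::'k. plate m e) x)) \<le> br_max \<alpha> (\<lambda>_::'k. plate m e) x"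
          unfolding br_max_def using that by (intro SUP_upper) auto
        then have "enn2real (ennreal (norm (br_mean \<alpha> R (\<lambda>_::'k. plate m e) x))) \<le> enn2real (br_max \<alpha> (\<lambda>_::'k. plate m e) x)"
          using False by (intro enn2real_mono) (auto simp: less_top)
        then show ?thesis by simp
      qed
      from key[OF this] have "ennreal (c * M powr (- ?s) / (1 + ln (1 + sqrt M))) \<le> ennreal (enn2real (br_max \<alpha> (\<lambda>_::'k. plate m e) x))"
        by (rule ennreal_leI)
      also have "\<dots> = br_max \<alpha> (\<lambda>_::'k. plate m e) x" using False by (simp add: less_top)
      finally show ?thesis by (simp only: M_def \<kappa>_def \<nu>_def)
    qed simp
  qed
qed

section \<open>Norm estimates\<close>

lemma epowr_ennreal: "y \<ge> 0 \<Longrightarrow> epowr (ennreal y) p = ennreal (y powr p)"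
  by (simp add: epowr_def)

lemma epowr_mono:
  assumes "a \<le> b" "p > 0"
  shows "epowr a p \<le> epowr b p"
proof (cases "b = \<infinity>")
  case False
  then have "a \<noteq> \<infinity>" using assms by (auto simp: top_unique)
  then show ?thesis using False assms
    by (auto simp: epowr_def less_top intro!: ennreal_leI powr_mono2 enn2real_mono)
qed (simp add: epowr_def)

text \<open>Chebyshev's inequality, for functions that may be infinite.\<close>

lemma Lp_norm_ge:
  assumes p: "p > 0" and A: "A \<in> sets lborel" "emeasure lborel A = ennreal V" "V \<ge> 0" and c: "c \<ge> 0"
    and g: "\<And>x. x \<in> A \<Longrightarrow> ennreal c \<le> g x"
  shows "ennreal (c * V powr (1/p)) \<le> Lp_norm p g"
proof -
  have "ennreal (c powr p * V) = (\<integral>\<^sup>+ x. ennreal (c powr p) * indicator A x \<partial>lborel)"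
    using A by (simp add: nn_integral_cmult_indicator ennreal_mult)
  also have "\<dots> \<le> (\<integral>\<^sup>+ x. epowr (g x) p \<partial>lborel)"
    using epowr_mono[OF g p] c by (intro nn_integral_mono) (auto simp: indicator_def epowr_ennreal)
  finally have "epowr (ennreal (c powr p * V)) (1/p) \<le> Lp_norm p g"
    unfolding Lp_norm_def using p by (intro epowr_mono) auto
  also have "epowr (ennreal (c powr p * V)) (1/p) = ennreal (c * V powr (1/p))"
    using p c A(3) by (simp add: epowr_ennreal powr_mult powr_powr)
  finally show ?thesis .
qed

lemma prod_mono_ennreal:
  fixes f g :: "'i \<Rightarrow> ennreal"
  shows "(\<And>i. i \<in> I \<Longrightarrow> f i \<le> g i) \<Longrightarrow> prod f I \<le> prod g I"
  by (induction I rule: infinite_finite_induct) (auto intro!: mult_mono)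

text \<open>The modulation has modulus 1, so only the volume of the plate, of order sqrt m, matters.
  Every one-dimensional integral carries a factor 1 / sqrt (P pi), which is below 1 and is
  dropped.\<close>

lemma Lp_norm_plate_le:
  fixes e :: "'a::euclidean_space"
  assumes P: "P > 1" and m: "m \<ge> 1" and e: "e \<in> Basis"
  shows "Lp_norm P (\<lambda>x. ennreal (norm (plate m e x))) \<le> ennreal (m powr (1 / (2 * P)))"
proof -
  let ?w = "stiffness m e"
  have w: "?w b \<ge> 1" if "b \<in> Basis" for b by (rule stiffness_ge_1[OF e that m])
  have n: "norm (plate m e x) = exp (\<Sum>b\<in>Basis. - (pi\<^sup>2 / ?w b) * (x \<bullet> b)\<^sup>2)" for x
    by (simp add: plate_def gauss_def)
  have pw: "epowr (ennreal (norm (plate m e x))) P = (\<Prod>b\<in>Basis. ennreal (exp (0 * (x \<bullet> b) - (P * pi\<^sup>2 / ?w b) * (x \<bullet> b)\<^sup>2)))" for x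
  proof -
    have "norm (plate m e x) powr P = exp (\<Sum>b\<in>Basis. 0 * (x \<bullet> b) - (P * pi\<^sup>2 / ?w b) * (x \<bullet> b)\<^sup>2)"
      unfolding n exp_powr_real sum_distrib_right by (intro arg_cong[of _ _ exp] sum.cong) auto
    then show ?thesis by (simp add: epowr_ennreal exp_sum prod_ennreal)
  qed
  have one: "(\<integral>\<^sup>+ t. ennreal (exp (0 * t - (P * pi\<^sup>2 / ?w b) * t\<^sup>2)) \<partial>lborel) = ennreal (sqrt (?w b / (P * pi)))" if "b \<in> Basis" for b
  proof -
    have A: "P * pi\<^sup>2 / ?w b > 0" using P w[OF that] by (intro divide_pos_pos mult_pos_pos) auto
    have "has_bochner_integral lborel (\<lambda>t. exp (0 * t - (P * pi\<^sup>2 / ?w b) * t\<^sup>2)) (sqrt pi * (P * pi\<^sup>2 / ?w b) powr (-1/2) * exp (0\<^sup>2 / (4 * (P * pi\<^sup>2 / ?w b))))"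
      by (rule has_bochner_integral_gaussian_real[OF A])
    then have "(\<integral>\<^sup>+ t. ennreal (exp (0 * t - (P * pi\<^sup>2 / ?w b) * t\<^sup>2)) \<partial>lborel) = ennreal (sqrt pi * (P * pi\<^sup>2 / ?w b) powr (-1/2) * exp (0\<^sup>2 / (4 * (P * pi\<^sup>2 / ?w b))))"
      by (subst nn_integral_eq_integral) (auto simp: has_bochner_integral_iff)
    also have "sqrt pi * (P * pi\<^sup>2 / ?w b) powr (-1/2) * exp (0\<^sup>2 / (4 * (P * pi\<^sup>2 / ?w b))) = sqrt (?w b / (P * pi))"
    proof -
      have X: "(P * pi\<^sup>2 / ?w b) powr (-1/2) = 1 / sqrt (P * pi\<^sup>2 / ?w b)"
        using A by (simp add: powr_minus_divide powr_half_sqrt)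
      have "sqrt pi * sqrt pi = pi" by simp
      then have "sqrt pi * (1 / sqrt (P * pi\<^sup>2 / ?w b)) = sqrt (?w b / (P * pi))"
        using P w[OF that] by (simp add: real_sqrt_divide real_sqrt_mult field_simps)
      then show ?thesis unfolding X by simp
    qed
    finally show ?thesis .
  qed
  have "(\<integral>\<^sup>+ x. epowr (ennreal (norm (plate m e x))) P \<partial>lborel)
      = (\<Prod>b\<in>Basis. \<integral>\<^sup>+ t. ennreal (exp (0 * t - (P * pi\<^sup>2 / ?w b) * t\<^sup>2)) \<partial>lborel)"
    unfolding pw by (rule nn_integral_lborel_prod) auto
  also have "\<dots> = (\<Prod>b\<in>Basis. ennreal (sqrt (?w b / (P * pi))))"
    by (intro prod.cong refl one)
  also have "\<dots> \<le> (\<Prod>b\<in>Basis. ennreal (sqrt (?w b)))"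
  proof (intro prod_mono_ennreal ennreal_leI real_sqrt_le_mono)
    fix b :: 'a assume b: "b \<in> Basis"
    have "1 * 1 \<le> P * pi" using P pi_gt3 by (intro mult_mono) auto
    then have "?w b / (P * pi) \<le> ?w b / 1" using w[OF b] by (intro divide_left_mono) auto
    then show "?w b / (P * pi) \<le> ?w b" by simp
  qed
  also have "\<dots> = ennreal (\<Prod>b\<in>Basis. sqrt (?w b))" using w by (intro prod_ennreal) (auto intro: order_trans[of 0 1])
  also have "(\<Prod>b\<in>Basis. sqrt (?w b)) = sqrt m"
  proof -
    have "(\<Prod>b\<in>Basis. sqrt (?w b)) = sqrt (?w e) * (\<Prod>b\<in>Basis - {e}. sqrt (?w b))" using e by (intro prod.remove) auto
    also have "(\<Prod>b\<in>Basis - {e}. sqrt (?w b)) = 1" using stiffness_Basis(2)[OF e, of _ m] by (intro prod.neutral) auto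
    finally show ?thesis using stiffness_Basis(1)[OF e] by simp
  qed
  finally have "Lp_norm P (\<lambda>x. ennreal (norm (plate m e x))) \<le> epowr (ennreal (sqrt m)) (1 / P)"
    unfolding Lp_norm_def using P by (intro epowr_mono) auto
  also have "\<dots> = ennreal (m powr (1 / (2 * P)))"
    using m P by (simp add: epowr_ennreal powr_half_sqrt[symmetric] powr_powr)
  finally show ?thesis .
qed

theorem theorem1p3:
  fixes P :: "'k::finite \<Rightarrow> real" and p \<alpha> :: real
  assumes "CARD('n::finite) \<ge> 2"
    and "\<And>\<iota>. 1 < P \<iota>"
    and "1 / p = (\<Sum>\<iota>\<in>UNIV. 1 / P \<iota>)"
    and "0 \<le> \<alpha>"
    and "\<alpha> < (2 * real CARD('n) - 1) / (2 * p)
              - ((real CARD('n) - 1) * real CARD('k) + 1) / 2"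
  shows "\<not> (\<exists>C::real. \<forall>f :: 'k \<Rightarrow> real^'n \<Rightarrow> complex.
            (\<forall>\<iota>. schwartz (f \<iota>)) \<longrightarrow>
            Lp_norm p (br_max \<alpha> f)
              \<le> ennreal C * (\<Prod>\<iota>\<in>UNIV. Lp_norm (P \<iota>) (\<lambda>x. ennreal (norm (f \<iota> x)))))"
proof
  assume "\<exists>C::real. \<forall>f :: 'k \<Rightarrow> real^'n \<Rightarrow> complex.
            (\<forall>\<iota>. schwartz (f \<iota>)) \<longrightarrow>
            Lp_norm p (br_max \<alpha> f)
              \<le> ennreal C * (\<Prod>\<iota>\<in>UNIV. Lp_norm (P \<iota>) (\<lambda>x. ennreal (norm (f \<iota> x))))"
  then obtain C where C: "\<And>f :: 'k \<Rightarrow> real^'n \<Rightarrow> complex. (\<And>\<iota>. schwartz (f \<iota>)) \<Longrightarrow>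
     Lp_norm p (br_max \<alpha> f) \<le> ennreal C * (\<Prod>\<iota>\<in>UNIV. Lp_norm (P \<iota>) (\<lambda>x. ennreal (norm (f \<iota> x))))" by blast
  have P: "P \<iota> > 1" for \<iota> by fact
  have "0 < (\<Sum>\<iota>\<in>UNIV. 1 / P \<iota>)"
    using P by (intro sum_pos) (auto intro: less_trans[OF zero_less_one])
  then have p: "p > 0" using assms(3) by (metis zero_less_divide_1_iff)
  define s where "s = \<alpha> + 1/2 + real CARD('k) * (real CARD('n) - 1) / 2"
  \<comment> \<open>The gap in the strict inequality for \<alpha>: the power of M left over to beat
    the logarithm.\<close>
  define \<eta> where "\<eta> = real CARD('n) / p - 1 / (2 * p) - s"
  have \<eta>: "\<eta> > 0"
  proof -
    have "(2 * real CARD('n) - 1) / (2 * p) = real CARD('n) / p - 1 / (2 * p)" using p by (simp add: field_simps)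
    then show ?thesis using assms(5) by (simp add: \<eta>_def s_def algebra_simps add_divide_distrib diff_divide_distrib)
  qed
  obtain c where c: "c > 0"
    "\<And>m e (x::real^'n). m \<ge> 1 \<Longrightarrow> e \<in> Basis \<Longrightarrow> m + 1 \<le> pi * (x \<bullet> e) \<Longrightarrow> pi * (x \<bullet> e) \<le> 2 * (m + 1)
       \<Longrightarrow> (\<And>b. b \<in> Basis \<Longrightarrow> b \<noteq> e \<Longrightarrow> \<bar>pi * (x \<bullet> b)\<bar> \<le> m + 1)
       \<Longrightarrow> ennreal (c * (m + 1) powr (- s) / (1 + ln (1 + sqrt (m + 1))))
         \<le> br_max \<alpha> (\<lambda>_::'k. plate m e) x"
    using br_max_plate_ge[OF assms(4), where 'n = 'n and 'k = 'k] unfolding s_def by blast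
  obtain e :: "real^'n" where e: "e \<in> Basis" using nonempty_Basis by blast
  define D where "D = \<bar>C\<bar> * pi powr (real CARD('n) / p) / c"
  have bound: "M powr \<eta> / (1 + ln (1 + sqrt M)) \<le> D" if M: "M \<ge> 2" for M
  proof -
    define m where "m = M - 1"
    have m: "m \<ge> 1" "m + 1 = M" using M by (auto simp: m_def)
    define r where "r = M / pi"
    have r: "r > 0" "pi * r = M" using M by (auto simp: r_def)
    \<comment> \<open>In the rescaled coordinates pi x, the cube of side M whose lowest corner is M
      e: it satisfies the hypotheses of \<open>c(2)\<close> and has volume (M/pi)^n.\<close>
    define A where "A = cbox (r *\<^sub>R e) (r *\<^sub>R e + r *\<^sub>R One)"
    have mA: "emeasure lborel A = ennreal (r ^ CARD('n))"
      unfolding A_def by (subst emeasure_lborel_cbox) (use r in \<open>auto simp: inner_add_left inner_diff_left\<close>)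
    define L where "L = 1 + ln (1 + sqrt M)"
    have L: "L > 0" using M by (auto simp: L_def intro!: add_pos_nonneg)
    have low: "ennreal (c * M powr (- s) / L) \<le> br_max \<alpha> (\<lambda>_::'k. plate m e) x" if x: "x \<in> A" for x
    proof -
      have xb: "r * (e \<bullet> b) \<le> x \<bullet> b" "x \<bullet> b \<le> r * (e \<bullet> b) + r" if "b \<in> Basis" for b
        using x that by (auto simp: A_def mem_box inner_add_left)
      have 1: "r \<le> x \<bullet> e" "x \<bullet> e \<le> 2 * r" using xb[OF e] e by auto
      have 2: "0 \<le> x \<bullet> b" "x \<bullet> b \<le> r" if "b \<in> Basis" "b \<noteq> e" for b
        using xb[OF that(1)] that e by (auto simp: inner_Basis)
      show ?thesis unfolding L_def m(2)[symmetric]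
      proof (rule c(2)[OF m(1) e])
        show "m + 1 \<le> pi * (x \<bullet> e)" unfolding m(2) r(2)[symmetric] using 1 by (intro mult_left_mono) auto
        have "pi * (x \<bullet> e) \<le> pi * (2 * r)" using 1 by (intro mult_left_mono) auto
        then show "pi * (x \<bullet> e) \<le> 2 * (m + 1)" unfolding m(2) r(2)[symmetric] by simp
        fix b assume "b \<in> (Basis :: (real^'n) set)" "b \<noteq> e"
        from 2[OF this] show "\<bar>pi * (x \<bullet> b)\<bar> \<le> m + 1"
          unfolding m(2) r(2)[symmetric] abs_mult by (intro mult_mono) auto
      qed
    qed
    have "ennreal (c * M powr (- s) / L * (r ^ CARD('n)) powr (1/p)) \<le> Lp_norm p (br_max \<alpha> (\<lambda>_::'k. plate m e))"
      by (rule Lp_norm_ge[OF p _ mA _ _ low]) (use r c L in \<open>auto simp: A_def\<close>)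
    also have "\<dots> \<le> ennreal C * (\<Prod>\<iota>\<in>UNIV. Lp_norm (P \<iota>) (\<lambda>x. ennreal (norm (plate m e x))))"
      by (rule C) (use m in \<open>auto intro!: schwartz_plate e\<close>)
    also have "\<dots> \<le> ennreal \<bar>C\<bar> * (\<Prod>\<iota>\<in>UNIV. ennreal (m powr (1 / (2 * P \<iota>))))"
      by (intro mult_mono prod_mono_ennreal Lp_norm_plate_le P m e ennreal_leI) auto
    \<comment> \<open>The relation between p and the exponents \<open>P \<iota>\<close> enters here:
      the plate norms multiply to a power that depends on p alone.\<close>
    also have "(\<Prod>\<iota>\<in>UNIV. ennreal (m powr (1 / (2 * P \<iota>)))) = ennreal (m powr (1 / (2 * p)))"
    proof -
      have "(\<Prod>\<iota>\<in>UNIV. m powr (1 / (2 * P \<iota>))) = m powr (\<Sum>\<iota>\<in>UNIV. 1 / (2 * P \<iota>))"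
        using m by (intro powr_sum[symmetric]) auto
      also have "(\<Sum>\<iota>\<in>UNIV. 1 / (2 * P \<iota>)) = 1/2 * (1 / p)"
        unfolding assms(3) sum_distrib_left by simp
      finally show ?thesis by (simp add: prod_ennreal)
    qed
    also have "ennreal \<bar>C\<bar> * ennreal (m powr (1 / (2 * p))) = ennreal (\<bar>C\<bar> * m powr (1 / (2 * p)))"
      by (simp add: ennreal_mult)
    finally have "c * M powr (- s) / L * (r ^ CARD('n)) powr (1/p) \<le> \<bar>C\<bar> * m powr (1 / (2 * p))"
      by (subst (asm) ennreal_le_iff) auto
    also have "\<dots> \<le> \<bar>C\<bar> * M powr (1 / (2 * p))"
      using m p by (intro mult_left_mono powr_mono2) auto
    also have "(r ^ CARD('n)) powr (1/p) = M powr (real CARD('n) / p) * pi powr (- (real CARD('n) / p))"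
    proof -
      have "(r ^ CARD('n)) powr (1/p) = r powr (real CARD('n) / p)"
        using r by (simp add: powr_realpow[symmetric] powr_powr)
      also have "\<dots> = M powr (real CARD('n) / p) / pi powr (real CARD('n) / p)"
        using M by (simp add: r_def powr_divide)
      finally show ?thesis by (simp add: powr_minus_divide)
    qed
    finally have "(c * M powr (- s) / L * (M powr (real CARD('n) / p) * pi powr (- (real CARD('n) / p)))) * M powr (- (1 / (2 * p)))
      \<le> (\<bar>C\<bar> * M powr (1 / (2 * p))) * M powr (- (1 / (2 * p)))"
      by (intro mult_right_mono) auto
    moreover have "M powr (1 / (2 * p)) * M powr (- (1 / (2 * p))) = 1" using M by (simp add: powr_add[symmetric])
    moreover have "M powr \<eta> = M powr (- s) * M powr (real CARD('n) / p) * M powr (- (1 / (2 * p)))"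
      unfolding powr_add[symmetric] \<eta>_def by (rule arg_cong[of _ _ "\<lambda>y. M powr y"]) simp
    ultimately have "c * pi powr (- (real CARD('n) / p)) * (M powr \<eta> / L) \<le> \<bar>C\<bar>" by (simp add: mult_ac)
    then have "(M powr \<eta> / L) \<le> \<bar>C\<bar> / (c * pi powr (- (real CARD('n) / p)))"
      using c(1) by (subst pos_le_divide_eq) (auto simp: mult_ac)
    then show ?thesis by (simp add: D_def L_def powr_minus_divide)
  qed
  \<comment> \<open>A positive power outgrows the logarithmic loss, so the fixed bound D is
    exceeded.\<close>
  have "filterlim (\<lambda>M. M powr \<eta> / (1 + ln (1 + sqrt M))) at_top at_top"
    using \<eta> by real_asymp
  then have "eventually (\<lambda>M. M powr \<eta> / (1 + ln (1 + sqrt M)) > D \<and> M \<ge> 2) at_top"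
    by (intro eventually_conj eventually_ge_at_top) (auto simp: filterlim_at_top_dense)
  then obtain M where "M powr \<eta> / (1 + ln (1 + sqrt M)) > D" "M \<ge> 2"
    using eventually_happens'[OF trivial_limit_at_top_linorder] by blast
  with bound[of M] show False by linarith
qed

end
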